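(* Let $\mathcal T$ be a balanced staged tree with leaves numbered $1,\dots,n$ from top to bottom. Let $\mathbb R[\bar p]$ be the polynomial ring on the subset of the variables $p_1,\dots,p_n$ obtained by removing every $p_r$ for which there is an $s>r$ with $\varphi_{\mathcal T}(p_r)=\varphi_{\mathcal T}(p_s)$, and let $\bar\varphi_{\mathcal T}$ be the restriction of $\varphi_{\mathcal T}$ to $\mathbb R[\bar p]$. Then the set of degree two binomials in $\ker\bar\varphi_{\mathcal T}$ is a Gröbner basis of $\ker\bar\varphi_{\mathcal T}$ with respect to the degree reverse lexicographic order (with the remaining variables ordered by $p_r\succ p_s$ for $r<s$).
   Context: A staged tree $\mathcal T$ is a finite rooted tree, edges directed away from the root, with an equivalence relation $\sim$ on vertices (classes are called stages or colours) and edge labels $\theta(e)$ such that: the outgoing edges of an inner vertex have pairwise distinct labels; inner vertices in the same stage have the same set of outgoing edge labels; inner vertices in different stages have disjoint sets of outgoing labels; leaves are (by convention) all in the same stage. Labels stand for probabilities in $(0,1)$ summing to one at each inner vertex, so each inner vertex has at least two children. The children of a vertex $v$ are written $v_1,\dots,v_k$ (listed from top to bottom in the drawing of the tree); the order is such that if $u\sim v$ is a stage with labels $\theta_1,\dots,\theta_k$, then the edges $(u,u_i)$ and $(v,v_i)$ both have label $\theta_i$. The leaves $1,\dots,n$ are numbered from top to bottom in this plane drawing. $\lambda_r$ is the root-to-leaf path ending in leaf $r$, $E(\lambda_r)$ its set of edges, $d(\lambda_r)=|E(\lambda_r)|$, and $d=\max_r d(\lambda_r)$. Treat the set $\Theta$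 of labels as variables, let $z$ be one extra variable, and let $\langle\theta-z\rangle\subset\mathbb R[\Theta,z]$ be the ideal generated by $\sum_{e\in E(v)}\theta(e)-z$ for all inner vertices $v$, where $E(v)$ is the set of outgoing edges of $v$. Define the $\mathbb R$-algebra map $$\varphi_{\mathcal T}:\mathbb R[p_1,\dots,p_n]\to\mathbb R[\Theta,z]/\langle\theta-z\rangle,\qquad p_r\mapsto z^{d-d(\lambda_r)}\prod_{e\in E(\lambda_r)}\theta(e).$$ For a vertex $v$, $t(v)\in\mathbb R[\Theta]$ is the sum over all $v$-to-leaf paths of the product of the labels along the path ($t(v)=1$ for a leaf). $\mathcal T$ is balanced if for any two vertices $u\sim v$ in the same stage, $t(u_i)t(v_j)=t(u_j)t(v_i)$ in $\mathbb R[\Theta]$ for all $i,j=1,\dots,k$. It is known that for balanced $\mathcal T$ the ideal $\ker\varphi_{\mathcal T}$ equals the kernel of the monomial map $\mathbb R[p_1,\dots,p_n]\to\mathbb R[\Theta,z]$ given by the same formula. Degree reverse lexicographic order: $p^\alpha\succ p^\beta$ if $\sum\alpha_i>\sum\beta_i$, or $\sum\alpha_i=\sum\beta_i$ and there is an $i$ with $\alpha_i<\beta_i$ and $\alpha_j=\beta_j$ for all $j>i$. *)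

theory Defs
  imports Complex_Main "HOL-Library.Poly_Mapping" "HOL-Algebra.QuotRing"
begin

section \<open>Polynomials over the reals in a set of variables\<close>

type_synonym 'x mpoly = "('x \<Rightarrow>\<^sub>0 nat) \<Rightarrow>\<^sub>0 real"

definition monom :: "('x \<Rightarrow>\<^sub>0 nat) \<Rightarrow> 'x mpoly" where
  "monom m = Poly_Mapping.single m 1"

definition const :: "real \<Rightarrow> 'x mpoly" where
  "const c = Poly_Mapping.single 0 c"

definition var :: "'x \<Rightarrow> 'x mpoly" where
  "var x = monom (Poly_Mapping.single x 1)"

definition poly_ring :: "'x set \<Rightarrow> 'x mpoly ring" where
  "poly_ring X = \<lparr>carrier = {f. \<forall>m\<in>Poly_Mapping.keys f. Poly_Mapping.keys m \<subseteq> X},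
                  mult = (*), one = 1, zero = 0, add = (+)\<rparr>"

text \<open>The \<open>\<real>\<close>-algebra map with \<open>x \<mapsto> g x\<close>.\<close>

definition subst :: "('x \<Rightarrow> 'y mpoly) \<Rightarrow> 'x mpoly \<Rightarrow> 'y mpoly" where
  "subst g f = (\<Sum>m\<in>Poly_Mapping.keys f. const (Poly_Mapping.lookup f m) *
                  (\<Prod>x\<in>Poly_Mapping.keys m. g x ^ Poly_Mapping.lookup m x))"

definition mon_degree :: "('x \<Rightarrow>\<^sub>0 nat) \<Rightarrow> nat" where
  "mon_degree m = (\<Sum>x\<in>Poly_Mapping.keys m. Poly_Mapping.lookup m x)"

definition total_degree :: "'x mpoly \<Rightarrow> nat" where
  "total_degree f = (MAX m\<in>Poly_Mapping.keys f. mon_degree m)"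

text \<open>Differences of two monomials, so that finitely many of them have a given degree. For a kernel
  of a map sending variables to monomials, any other two-term element is a scalar multiple of
  such a difference.\<close>

definition is_binomial :: "'x mpoly \<Rightarrow> bool" where
  "is_binomial f \<longleftrightarrow> (\<exists>a b. a \<noteq> b \<and> f = monom a - monom b)"

lemma cring_poly_ring: "cring (poly_ring (X :: 'x set))"
proof -
  let ?C = "{f :: 'x mpoly. \<forall>m\<in>Poly_Mapping.keys f. Poly_Mapping.keys m \<subseteq> X}"
  have add: "f + g \<in> ?C" if "f \<in> ?C" "g \<in> ?C" for f g
    using that Poly_Mapping.keys_add[of f g] by blast
  have mult: "f * g \<in> ?C" if "f \<in> ?C" "g \<in> ?C" for f g
  proof (intro CollectI ballI)
    fix m assume "m \<in> Poly_Mapping.keys (f * g)"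
    then obtain a b where "m = a + b" "a \<in> Poly_Mapping.keys f" "b \<in> Poly_Mapping.keys g"
      using keys_mult[of f g] by blast
    then show "Poly_Mapping.keys m \<subseteq> X"
      using that Poly_Mapping.keys_add[of a b] by blast
  qed
  have zero: "0 \<in> ?C" and one: "1 \<in> ?C"
    by (auto simp: keys_one)
  have inv: "\<exists>g\<in>?C. g + f = 0" if "f \<in> ?C" for f
    using that by (intro bexI[of _ "- f"]) auto
  show ?thesis
  proof (rule cringI)
    show "abelian_group (poly_ring X)"
      using add zero inv
      by (intro abelian_groupI) (simp_all only: poly_ring_def ring_record_simps ac_simps add_0_left add_0_right)
  next
    show "Group.comm_monoid (poly_ring X)"
      using mult one
      by (intro comm_monoidI) (simp_all only: poly_ring_def monoid.simps partial_object.simps ring_record_simps ac_simps mult_1_left mult_1_right)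
  qed (simp add: poly_ring_def distrib_right)
qed

section \<open>Groebner bases and the degree reverse lexicographic order\<close>

text \<open>Variables are natural numbers; \<open>drl_gt a b\<close> means that \<open>a\<close> is the larger monomial, and the
  order of the variables is \<open>p\<^sub>r \<succ> p\<^sub>s\<close> for \<open>r < s\<close>.\<close>

definition drl_gt :: "(nat \<Rightarrow>\<^sub>0 nat) \<Rightarrow> (nat \<Rightarrow>\<^sub>0 nat) \<Rightarrow> bool" where
  "drl_gt a b \<longleftrightarrow> mon_degree a > mon_degree b \<or>
     mon_degree a = mon_degree b \<and>
     (\<exists>i. Poly_Mapping.lookup a i < Poly_Mapping.lookup b i \<and>
          (\<forall>j>i. Poly_Mapping.lookup a j = Poly_Mapping.lookup b j))"

definition lead_mon ::
  "(('x \<Rightarrow>\<^sub>0 nat) \<Rightarrow> ('x \<Rightarrow>\<^sub>0 nat) \<Rightarrow> bool) \<Rightarrow> 'x mpoly \<Rightarrow> ('x \<Rightarrow>\<^sub>0 nat)" where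
  "lead_mon gt f = (THE m. m \<in> Poly_Mapping.keys f \<and>
                           (\<forall>m'\<in>Poly_Mapping.keys f. m' \<noteq> m \<longrightarrow> gt m m'))"

definition initial_ideal ::
  "(('x \<Rightarrow>\<^sub>0 nat) \<Rightarrow> ('x \<Rightarrow>\<^sub>0 nat) \<Rightarrow> bool) \<Rightarrow> 'x set \<Rightarrow> 'x mpoly set \<Rightarrow> 'x mpoly set" where
  "initial_ideal gt X S = Idl\<^bsub>poly_ring X\<^esub> {monom (lead_mon gt f) | f. f \<in> S \<and> f \<noteq> 0}"

definition groebner_basis ::
  "(('x \<Rightarrow>\<^sub>0 nat) \<Rightarrow> ('x \<Rightarrow>\<^sub>0 nat) \<Rightarrow> bool) \<Rightarrow> 'x set \<Rightarrow> 'x mpoly set \<Rightarrow> 'x mpoly set \<Rightarrow> bool" where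
  "groebner_basis gt X G I \<longleftrightarrow>
     finite G \<and> G \<subseteq> I \<and> initial_ideal gt X G = initial_ideal gt X I"

section \<open>Staged trees\<close>

text \<open>A plane rooted tree with labelled edges: the list of branches of a node is ordered from top
  to bottom. A vertex is addressed by the list of (0-based) child positions on the path from
  the root.\<close>

datatype 'l plane_tree = Node (branches: "('l \<times> 'l plane_tree) list")

primrec is_vertex :: "nat list \<Rightarrow> 'l plane_tree \<Rightarrow> bool" where
  "is_vertex [] T \<longleftrightarrow> True"
| "is_vertex (i # v) T \<longleftrightarrow> i < length (branches T) \<and> is_vertex v (snd (branches T ! i))"

primrec subtree :: "'l plane_tree \<Rightarrow> nat list \<Rightarrow> 'l plane_tree" where
  "subtree T [] = T"
| "subtree T (i # v) = subtree (snd (branches T ! i)) v"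

definition vertices :: "'l plane_tree \<Rightarrow> nat list set" where
  "vertices T = {v. is_vertex v T}"

definition out_labels :: "'l plane_tree \<Rightarrow> nat list \<Rightarrow> 'l list" where
  "out_labels T v = map fst (branches (subtree T v))"

definition inner_vertices :: "'l plane_tree \<Rightarrow> nat list set" where
  "inner_vertices T = {v \<in> vertices T. out_labels T v \<noteq> []}"

definition leaves :: "'l plane_tree \<Rightarrow> nat list set" where
  "leaves T = {v \<in> vertices T. out_labels T v = []}"

definition labels :: "'l plane_tree \<Rightarrow> 'l set" where
  "labels T = (\<Union>v\<in>vertices T. set (out_labels T v))"

text \<open>The third conjunct says both that vertices in the same stage have the same set of outgoing
  labels and that their children are listed in the same order; for a leaf it says that only
  leaves are in its stage. The one-vertex tree satisfies this definition; there \<open>\<phi>(p\<^sub>1) = 1\<close> and the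
  kernel is not homogeneous, so statements about degrees need to assume that the root is inner.\<close>

definition staged_tree :: "'l plane_tree \<Rightarrow> nat list rel \<Rightarrow> bool" where
  "staged_tree T sim \<longleftrightarrow>
     equiv (vertices T) sim \<and>
     (\<forall>v\<in>inner_vertices T. 2 \<le> length (out_labels T v) \<and> distinct (out_labels T v)) \<and>
     (\<forall>(u, v)\<in>sim. out_labels T u = out_labels T v) \<and>
     (\<forall>u\<in>inner_vertices T. \<forall>v\<in>inner_vertices T.
        (u, v) \<notin> sim \<longrightarrow> set (out_labels T u) \<inter> set (out_labels T v) = {}) \<and>
     (\<forall>u\<in>leaves T. \<forall>v\<in>leaves T. (u, v) \<in> sim)"

text \<open>The label sequences of the root-to-leaf paths, leaves being listed from top to bottom.\<close>

fun leaf_paths :: "'l plane_tree \<Rightarrow> 'l list list" where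
  "leaf_paths (Node bs) =
     (if bs = [] then [[]]
      else concat (map (\<lambda>(\<theta>, S). map ((#) \<theta>) (leaf_paths S)) bs))"

definition interpolating_poly :: "'l plane_tree \<Rightarrow> nat list \<Rightarrow> 'l mpoly" where
  "interpolating_poly T v =
     (\<Sum>path\<leftarrow>leaf_paths (subtree T v). \<Prod>\<theta>\<leftarrow>path. var \<theta>)"

definition balanced :: "'l plane_tree \<Rightarrow> nat list rel \<Rightarrow> bool" where
  "balanced T sim \<longleftrightarrow>
     (\<forall>(u, v)\<in>sim. \<forall>i<length (out_labels T u). \<forall>j<length (out_labels T u).
        interpolating_poly T (u @ [i]) * interpolating_poly T (v @ [j]) =
        interpolating_poly T (u @ [j]) * interpolating_poly T (v @ [i]))"

section \<open>The parametrisation\<close>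

datatype 'l param = Lab 'l | Z

definition param_ring :: "'l plane_tree \<Rightarrow> 'l param mpoly ring" where
  "param_ring T = poly_ring (insert Z (Lab ` labels T))"

definition sum_ideal :: "'l plane_tree \<Rightarrow> 'l param mpoly set" where
  "sum_ideal T = Idl\<^bsub>param_ring T\<^esub>
     {(\<Sum>\<theta>\<leftarrow>out_labels T v. var (Lab \<theta>)) - var Z | v. v \<in> inner_vertices T}"

definition quot_ring :: "'l plane_tree \<Rightarrow> 'l param mpoly set ring" where
  "quot_ring T = param_ring T Quot sum_ideal T"

definition num_leaves :: "'l plane_tree \<Rightarrow> nat" where
  "num_leaves T = length (leaf_paths T)"

text \<open>The leaves are numbered from 1.\<close>

definition leaf_path :: "'l plane_tree \<Rightarrow> nat \<Rightarrow> 'l list" where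
  "leaf_path T r = leaf_paths T ! (r - 1)"

definition max_depth :: "'l plane_tree \<Rightarrow> nat" where
  "max_depth T = (MAX r\<in>{1..num_leaves T}. length (leaf_path T r))"

definition leaf_monomial :: "'l plane_tree \<Rightarrow> nat \<Rightarrow> 'l param mpoly" where
  "leaf_monomial T r =
     var Z ^ (max_depth T - length (leaf_path T r)) * (\<Prod>\<theta>\<leftarrow>leaf_path T r. var (Lab \<theta>))"

text \<open>The map \<open>\<phi>\<^sub>T\<close> on \<open>\<real>[p\<^sub>1, \<dots>, p\<^sub>n]\<close>; its values are cosets of \<open>sum_ideal T\<close>.\<close>

definition phi :: "'l plane_tree \<Rightarrow> nat mpoly \<Rightarrow> 'l param mpoly set" where
  "phi T = (\<lambda>f\<in>carrier (poly_ring {1..num_leaves T}).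
              sum_ideal T +>\<^bsub>param_ring T\<^esub> subst (leaf_monomial T) f)"

definition kept_indices :: "'l plane_tree \<Rightarrow> nat set" where
  "kept_indices T = {r \<in> {1..num_leaves T}.
     \<not> (\<exists>s\<in>{1..num_leaves T}. s > r \<and> phi T (var r) = phi T (var s))}"

definition phi_bar :: "'l plane_tree \<Rightarrow> nat mpoly \<Rightarrow> 'l param mpoly set" where
  "phi_bar T = restrict (phi T) (carrier (poly_ring (kept_indices T)))"

definition ker_phi_bar :: "'l plane_tree \<Rightarrow> nat mpoly set" where
  "ker_phi_bar T = a_kernel (poly_ring (kept_indices T)) (quot_ring T) (phi_bar T)"

end

theory Submission
  imports Defs "HOL-Library.Multiset"
begin

text \<open>
  Why the theorem is true. Two facts about a balanced staged tree carry the proof.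

  The kernel is toric. Write \<open>t(u)\<close> for the interpolating polynomial of a vertex and \<open>u\<^sub>i\<close> for its
  children. Take positive reals \<open>x\<^sub>\<theta>\<close> and \<open>s\<close> with no condition on their sums, and weigh the leaf at
  the end of the path \<open>\<lambda>\<close> by \<open>s\<close> times the product of the \<open>x\<^sub>\<theta>\<close> along \<open>\<lambda>\<close>. The conditional probability
  of the \<open>i\<close>-th edge at \<open>u\<close> is then \<open>x\<^sub>i t(u\<^sub>i)(x) / t(u)(x)\<close>, and balancedness says that it depends on
  the label of the edge alone. So these weights are also obtained from parameters that satisfy the
  sum-to-\<open>z\<close> relations. A polynomial killed by \<open>\<phi>\<close> therefore vanishes at all such weights, and as
  distinct monomials are independent functions of \<open>(s, x)\<close>, it is a combination of differences of
  monomials with equal image: equal degree and equal multiset of path labels.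

  Hence it is enough to show that, of two monomials in the kept variables with equal image, the
  larger one is divisible by the leading term of a quadratic binomial (\<open>pair_moves_up\<close>). Let \<open>b\<close> be
  the highest index where they differ, let \<open>a\<close> be the highest leaf below \<open>b\<close> that occurs in the
  larger monomial, and let the paths to \<open>a\<close> and \<open>b\<close> separate at \<open>u\<close>, with labels \<open>\<theta>\<^sub>i\<close> and \<open>\<theta>\<^sub>j\<close>, where
  \<open>i < j\<close>. Comparing label counts, \<open>\<theta>\<^sub>j\<close> must occur in the larger monomial below index \<open>b\<close> more often
  than on the way from the root to \<open>u\<close>.

  If it occurs on the path to another factor \<open>p\<^sub>c\<close> with \<open>c \<le> a\<close>, say at \<open>v \<sim> u\<close>, the monomials of
  \<open>t(u\<^sub>i) t(v\<^sub>j) = t(u\<^sub>j) t(v\<^sub>i)\<close> exchange the two labels and give \<open>p\<^sub>a p\<^sub>c - p\<^sub>a\<^sub>' p\<^sub>c\<^sub>'\<close> in the kernel with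
  \<open>a' > a \<ge> c\<close> (\<open>exchange_between_paths\<close>).

  Otherwise \<open>\<theta>\<^sub>j\<close> occurs on the path to \<open>a\<close> below \<open>u\<^sub>i\<close>. This is the delicate case: only one path is
  at hand. It is settled by the identity \<open>\<partial>t(u\<^sub>i)/\<partial>\<theta>\<^sub>j = \<partial>t(u\<^sub>j)/\<partial>\<theta>\<^sub>i\<close>. For a lowest vertex \<open>v\<close> of the
  stage, the polynomials \<open>c\<^sub>l = t(v\<^sub>l)\<close> are free of the stage's labels, and by induction along the tree
  the derivation \<open>c\<^sub>j \<partial>/\<partial>\<theta>\<^sub>i - c\<^sub>i \<partial>/\<partial>\<theta>\<^sub>j\<close> annihilates \<open>t(w)\<close> for each vertex \<open>w\<close>; with \<open>w = u\<^sub>i\<close> and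
  the \<open>\<theta>\<^sub>i\<close>-derivative of \<open>t(u\<^sub>i) c\<^sub>j = t(u\<^sub>j) c\<^sub>i\<close> this gives the identity. Comparing monomials
  (\<open>exchange_within_path\<close>) yields a leaf after \<open>a\<close> with the same image as \<open>a\<close>, so \<open>p\<^sub>a\<close> was not kept.
\<close>

section \<open>Evaluating polynomials at real points\<close>

text \<open>The values lie in an arbitrary commutative monoid because the variables \<open>p\<^sub>r\<close> are replaced both by
  real numbers and by the monomials that parametrise them.\<close>

definition mon_val :: "('x \<Rightarrow> 'a) \<Rightarrow> ('x \<Rightarrow>\<^sub>0 nat) \<Rightarrow> 'a :: comm_monoid_mult" where
  "mon_val y m = (\<Prod>x\<in>Poly_Mapping.keys m. y x ^ Poly_Mapping.lookup m x)"

definition eval_poly :: "('x \<Rightarrow> real) \<Rightarrow> 'x mpoly \<Rightarrow> real" where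
  "eval_poly y f = (\<Sum>m\<in>Poly_Mapping.keys f. Poly_Mapping.lookup f m * mon_val y m)"

lemma mon_val_superset:
  assumes "finite A" "Poly_Mapping.keys m \<subseteq> A"
  shows "mon_val y m = (\<Prod>x\<in>A. y x ^ Poly_Mapping.lookup m x)"
  unfolding mon_val_def using assms
  by (intro prod.mono_neutral_left) (auto simp: in_keys_iff)

lemma mon_val_add: "mon_val y (a + b) = mon_val y a * mon_val y b"
proof -
  let ?A = "Poly_Mapping.keys a \<union> Poly_Mapping.keys b"
  have "mon_val y (a + b) = (\<Prod>x\<in>?A. y x ^ Poly_Mapping.lookup (a + b) x)"
    by (rule mon_val_superset) (use Poly_Mapping.keys_add[of a b] in auto)
  also have "\<dots> = (\<Prod>x\<in>?A. y x ^ Poly_Mapping.lookup a x) * (\<Prod>x\<in>?A. y x ^ Poly_Mapping.lookup b x)"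
    by (simp add: lookup_add power_add prod.distrib)
  also have "\<dots> = mon_val y a * mon_val y b"
    by (simp add: mon_val_superset[of ?A])
  finally show ?thesis .
qed

lemma mon_val_0 [simp]: "mon_val y 0 = 1"
  by (simp add: mon_val_def)

lemma mon_val_single [simp]: "mon_val y (Poly_Mapping.single x k) = y x ^ k"
  by (cases "k = 0") (simp_all add: mon_val_def)

lemma eval_poly_superset:
  assumes "finite A" "Poly_Mapping.keys f \<subseteq> A"
  shows "eval_poly y f = (\<Sum>m\<in>A. Poly_Mapping.lookup f m * mon_val y m)"
  unfolding eval_poly_def using assms
  by (intro sum.mono_neutral_left) (auto simp: in_keys_iff)

lemma eval_poly_add: "eval_poly y (f + g) = eval_poly y f + eval_poly y g"
proof -
  let ?A = "Poly_Mapping.keys f \<union> Poly_Mapping.keys g"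
  have "eval_poly y (f + g) = (\<Sum>m\<in>?A. Poly_Mapping.lookup (f + g) m * mon_val y m)"
    by (rule eval_poly_superset) (use Poly_Mapping.keys_add[of f g] in auto)
  also have "\<dots> = eval_poly y f + eval_poly y g"
    by (simp add: eval_poly_superset[of ?A] lookup_add distrib_right sum.distrib)
  finally show ?thesis .
qed

lemma eval_poly_0 [simp]: "eval_poly y 0 = 0"
  by (simp add: eval_poly_def)

lemma eval_poly_single [simp]: "eval_poly y (Poly_Mapping.single m c) = c * mon_val y m"
  by (cases "c = 0") (simp_all add: eval_poly_def)

lemma eval_poly_diff: "eval_poly y (f - g) = eval_poly y f - eval_poly y g"
  using eval_poly_add[of y "f - g" g] by simp

lemma eval_poly_sum: "eval_poly y (sum f A) = (\<Sum>a\<in>A. eval_poly y (f a))"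
  by (induction A rule: infinite_finite_induct) (simp_all add: eval_poly_add)

lemma poly_mapping_sum_singles:
  "f = (\<Sum>m\<in>Poly_Mapping.keys f. Poly_Mapping.single m (Poly_Mapping.lookup f m))"
  by (rule poly_mapping_eqI)
    (auto simp: lookup_sum lookup_single when_def in_keys_iff sum.delta)

lemma eval_poly_mult: "eval_poly y (f * g) = eval_poly y f * eval_poly y g"
proof -
  let ?F = "\<lambda>f m. Poly_Mapping.single m (Poly_Mapping.lookup f m) :: 'a mpoly"
  have "f * g = (\<Sum>a\<in>Poly_Mapping.keys f. ?F f a) * (\<Sum>b\<in>Poly_Mapping.keys g. ?F g b)"
    using poly_mapping_sum_singles[of f] poly_mapping_sum_singles[of g] by simp
  also have "\<dots> = (\<Sum>a\<in>Poly_Mapping.keys f. \<Sum>b\<in>Poly_Mapping.keys g. Poly_Mapping.single (a + b)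
                    (Poly_Mapping.lookup f a * Poly_Mapping.lookup g b))"
    by (simp add: sum_product mult_single)
  finally have "eval_poly y (f * g) = (\<Sum>a\<in>Poly_Mapping.keys f. \<Sum>b\<in>Poly_Mapping.keys g.
      Poly_Mapping.lookup f a * Poly_Mapping.lookup g b * mon_val y (a + b))"
    by (simp add: eval_poly_sum)
  then show ?thesis
    by (simp add: mon_val_add eval_poly_def sum_product algebra_simps)
qed

lemma eval_poly_const [simp]: "eval_poly y (const c) = c"
  by (simp add: const_def)

lemma eval_poly_monom [simp]: "eval_poly y (monom m) = mon_val y m"
  by (simp add: monom_def)

lemma eval_poly_var [simp]: "eval_poly y (var x) = y x"
  by (simp add: var_def)

lemma eval_poly_1 [simp]: "eval_poly y 1 = 1"
  using eval_poly_const[of y 1] by (simp add: const_def)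

lemma eval_poly_power: "eval_poly y (f ^ k) = eval_poly y f ^ k"
  by (induction k) (simp_all add: eval_poly_mult)

lemma eval_poly_prod: "eval_poly y (prod f A) = (\<Prod>a\<in>A. eval_poly y (f a))"
  by (induction A rule: infinite_finite_induct) (simp_all add: eval_poly_mult)

lemma eval_poly_sum_list: "eval_poly y (\<Sum>a\<leftarrow>as. f a) = (\<Sum>a\<leftarrow>as. eval_poly y (f a))"
  by (induction as) (simp_all add: eval_poly_add)

lemma eval_poly_prod_list: "eval_poly y (\<Prod>a\<leftarrow>as. f a) = (\<Prod>a\<leftarrow>as. eval_poly y (f a))"
  by (induction as) (simp_all add: eval_poly_mult)

lemma eval_poly_subst: "eval_poly y (subst g f) = eval_poly (\<lambda>x. eval_poly y (g x)) f"
  by (simp add: subst_def eval_poly_sum eval_poly_mult eval_poly_prod eval_poly_power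
      eval_poly_def[of _ f] mon_val_def)

lemma eval_poly_cong:
  assumes "f \<in> carrier (poly_ring X)" "\<And>x. x \<in> X \<Longrightarrow> y x = y' x"
  shows "eval_poly y f = eval_poly y' f"
proof -
  have "mon_val y m = mon_val y' m" if "m \<in> Poly_Mapping.keys f" for m
  proof -
    have "y x = y' x" if "x \<in> Poly_Mapping.keys m" for x
      using assms \<open>m \<in> Poly_Mapping.keys f\<close> that by (auto simp: poly_ring_def)
    then show ?thesis
      by (simp add: mon_val_def)
  qed
  then show ?thesis
    by (simp add: eval_poly_def)
qed

section \<open>Independence of monomial functions\<close>

text \<open>A monomial in the labels is the multiset of its factors, since it arises as the list of labels
  along a path with the order forgotten.\<close>

definition label_val :: "('l \<Rightarrow> real) \<Rightarrow> 'l multiset \<Rightarrow> real" where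
  "label_val x N = (\<Prod>\<theta>\<in>#N. x \<theta>)"

lemma label_val_empty [simp]: "label_val x {#} = 1"
  and label_val_add_mset [simp]: "label_val x (add_mset a N) = x a * label_val x N"
  and label_val_union: "label_val x (N + N') = label_val x N * label_val x N'"
  by (simp_all add: label_val_def)

lemma label_val_pos: "(\<And>\<theta>. x \<theta> > 0) \<Longrightarrow> label_val x N > 0"
  by (induction N) auto

lemma label_val_mult: "label_val (\<lambda>\<theta>. x \<theta> * y \<theta>) N = label_val x N * label_val y N"
  by (induction N) auto

lemma label_val_update: "label_val ((\<lambda>_. 1)(a := c)) N = c ^ count N a"
  by (induction N) auto

lemma label_val_mset: "label_val x (mset p) = (\<Prod>\<theta>\<leftarrow>p. x \<theta>)"
  by (induction p) auto

text \<open>The functions \<open>(s, x) \<mapsto> s\<^sup>k x\<^sup>N\<close> are distinct characters of a group of positive reals, and distinct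
  characters are linearly independent; the proof is Dedekind's. Every comparison of
  coefficients below rests on it. The additional coordinate \<open>s\<close> records the degree in the variables \<open>p\<^sub>r\<close>.\<close>

lemma label_monomials_independent:
  fixes c :: "nat \<times> 'l multiset \<Rightarrow> real"
  assumes "finite K"
    and "\<And>s x. s > 0 \<Longrightarrow> (\<And>\<theta>. x \<theta> > 0) \<Longrightarrow> (\<Sum>(k, N)\<in>K. c (k, N) * (s ^ k * label_val x N)) = 0"
    and "kN \<in> K"
  shows "c kN = 0"
  using assms
proof (induction K arbitrary: c kN rule: finite_induct)
  case empty
  then show ?case by simp
next
  case (insert lM K)
  define chi :: "real \<Rightarrow> ('l \<Rightarrow> real) \<Rightarrow> nat \<times> 'l multiset \<Rightarrow> real"
    where "chi = (\<lambda>s x (k, N). s ^ k * label_val x N)"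
  have chi_mult: "chi (s * s') (\<lambda>\<theta>. x \<theta> * x' \<theta>) p = chi s x p * chi s' x' p" for s s' x x' p
    by (auto simp: chi_def power_mult_distrib label_val_mult split: prod.splits)
  have rel: "c lM * chi s x lM + (\<Sum>p\<in>K. c p * chi s x p) = 0"
    if "s > 0" "\<And>\<theta>. x \<theta> > 0" for s x
    using insert.prems(1)[OF that] insert.hyps by (simp add: chi_def case_prod_unfold)
  have vanish: "c p = 0" if "p \<in> K" for p
  proof -
    have "\<exists>s' x'. s' > 0 \<and> (\<forall>\<theta>. x' \<theta> > 0) \<and> chi s' x' p \<noteq> chi s' x' lM"
    proof (cases "fst p = fst lM")
      case False
      then have "chi 2 (\<lambda>_. 1) p \<noteq> chi 2 (\<lambda>_. 1) lM"
        by (auto simp: chi_def label_val_def split: prod.splits)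
      then show ?thesis
        by (intro exI[of _ 2] exI[of _ "\<lambda>_. 1"]) auto
    next
      case True
      then have "snd p \<noteq> snd lM"
        using that insert.hyps by (metis prod_eqI)
      then obtain a where a: "count (snd p) a \<noteq> count (snd lM) a"
        by (metis multiset_eqI)
      then have "chi 1 ((\<lambda>_. 1)(a := 2)) p \<noteq> chi 1 ((\<lambda>_. 1)(a := 2)) lM"
        by (auto simp: chi_def label_val_update split: prod.splits)
      then show ?thesis
        by (intro exI[of _ 1] exI[of _ "(\<lambda>_. 1)(a := 2)"]) auto
    qed
    then obtain s' x' where sep: "s' > 0" "\<And>\<theta>. x' \<theta> > 0" "chi s' x' p \<noteq> chi s' x' lM"
      by blast
    \<comment> \<open>Translating the relation by the separating point and subtracting a multiple of the original
      one removes the term of \<open>lM\<close> and multiplies the coefficient of \<open>p\<close> by a nonzero number.\<close>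
    define c' where "c' q = c q * (chi s' x' q - chi s' x' lM)" for q
    have "c' p = 0"
    proof (rule insert.IH[OF _ that])
      fix s x assume sx: "s > (0 :: real)" "\<And>\<theta> :: 'l. x \<theta> > (0 :: real)"
      have "c lM * chi (s * s') (\<lambda>\<theta>. x \<theta> * x' \<theta>) lM
              + (\<Sum>q\<in>K. c q * chi (s * s') (\<lambda>\<theta>. x \<theta> * x' \<theta>) q)
            - chi s' x' lM * (c lM * chi s x lM + (\<Sum>q\<in>K. c q * chi s x q)) = 0"
        using rel[of "s * s'" "\<lambda>\<theta>. x \<theta> * x' \<theta>"] rel[of s x] sx sep by simp
      then have "(\<Sum>q\<in>K. c' q * chi s x q) = 0"
        by (simp add: chi_mult c'_def algebra_simps sum_distrib_left sum_subtractf)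
      then show "(\<Sum>(k, N)\<in>K. c' (k, N) * (s ^ k * label_val x N)) = 0"
        by (simp add: chi_def case_prod_unfold)
    qed
    with sep show ?thesis
      by (simp add: c'_def)
  qed
  have "c lM * chi 1 (\<lambda>_. 1) lM = 0"
    using rel[of 1 "\<lambda>_. 1"] vanish by simp
  then have "c lM = 0"
    by (auto simp: chi_def label_val_def split: prod.splits)
  then show ?case
    using vanish[of kN] insert.prems(2) by blast
qed

text \<open>A multiset of monomials is a polynomial with natural number coefficients. Interpolating polynomials
  have this form, and a membership statement about multisets then says that a monomial occurs.\<close>

definition nat_poly_val :: "('l \<Rightarrow> real) \<Rightarrow> 'l multiset multiset \<Rightarrow> real" where
  "nat_poly_val x A = (\<Sum>N\<in>#A. label_val x N)"

lemma nat_poly_val_empty [simp]: "nat_poly_val x {#} = 0"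
  and nat_poly_val_add_mset [simp]: "nat_poly_val x (add_mset N A) = label_val x N + nat_poly_val x A"
  and nat_poly_val_union: "nat_poly_val x (A + B) = nat_poly_val x A + nat_poly_val x B"
  by (simp_all add: nat_poly_val_def)

lemma nat_poly_val_pos: "(\<And>\<theta>. x \<theta> > 0) \<Longrightarrow> A \<noteq> {#} \<Longrightarrow> nat_poly_val x A > 0"
proof (induction A)
  case (add N A)
  then show ?case
    using label_val_pos[of x N] by (cases "A = {#}") (auto intro: add_pos_pos)
qed simp

text \<open>Evaluation at positive points determines a polynomial, so identities may be proved, and factors
  cancelled, on real values and then read off monomial by monomial.\<close>

lemma nat_poly_val_inject:
  fixes A B :: "'l multiset multiset"
  assumes "\<And>x. (\<And>\<theta>. x \<theta> > 0) \<Longrightarrow> nat_poly_val x A = nat_poly_val x B"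
  shows "A = B"
proof (rule multiset_eqI)
  fix N
  define K where "K = set_mset A \<union> set_mset B \<union> {N}"
  have fin: "finite K" and sub: "set_mset A \<subseteq> K" "set_mset B \<subseteq> K"
    by (auto simp: K_def)
  have expand: "nat_poly_val x C = (\<Sum>N\<in>K. real (count C N) * label_val x N)" if "set_mset C \<subseteq> K" for C x
    using that
  proof (induction C)
    case (add M C)
    have "(\<Sum>N\<in>K. real (count (add_mset M C) N) * label_val x N) =
          (\<Sum>N\<in>K. (if N = M then label_val x N else 0) + real (count C N) * label_val x N)"
      by (intro sum.cong) (auto simp: algebra_simps)
    also have "\<dots> = label_val x M + (\<Sum>N\<in>K. real (count C N) * label_val x N)"
      using add.prems fin by (simp add: sum.distrib)
    finally show ?case using add by simp
  qed simp
  have "(\<lambda>(k, N). real (count A N) - real (count B N)) (0 :: nat, N) = 0"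
  proof (rule label_monomials_independent[of "Pair 0 ` K"])
    fix s :: real and x :: "'l \<Rightarrow> real"
    assume "\<And>\<theta>. x \<theta> > 0"
    then have "nat_poly_val x A = nat_poly_val x B"
      by (rule assms)
    then have "(\<Sum>N\<in>K. (real (count A N) - real (count B N)) * label_val x N) = 0"
      using expand[of A x, OF sub(1)] expand[of B x, OF sub(2)]
      by (simp add: left_diff_distrib sum_subtractf)
    then show "(\<Sum>(k, N)\<in>Pair 0 ` K. (case (k, N) of (k, N) \<Rightarrow> real (count A N) - real (count B N)) *
        (s ^ k * label_val x N)) = 0"
      by (subst sum.reindex) (auto simp: inj_on_def)
  qed (use fin in \<open>auto simp: K_def\<close>)
  then show "count A N = count B N"
    by simp
qed

section \<open>Multisets of monomials\<close>

definition nat_poly_times :: "'l multiset multiset \<Rightarrow> 'l multiset multiset \<Rightarrow> 'l multiset multiset" where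
  "nat_poly_times A B = (\<Sum>N\<in>#A. image_mset ((+) N) B)"

lemma nat_poly_times_empty [simp]: "nat_poly_times {#} B = {#}"
  and nat_poly_times_add_mset [simp]:
    "nat_poly_times (add_mset N A) B = image_mset ((+) N) B + nat_poly_times A B"
  by (simp_all add: nat_poly_times_def)

lemma in_nat_poly_times_iff: "K \<in># nat_poly_times A B \<longleftrightarrow> (\<exists>M\<in>#A. \<exists>N\<in>#B. K = M + N)"
  by (induction A) auto

lemma nat_poly_val_image_plus: "nat_poly_val x (image_mset ((+) N) B) = label_val x N * nat_poly_val x B"
  by (induction B) (simp_all add: label_val_union algebra_simps)

lemma nat_poly_val_product: "nat_poly_val x (nat_poly_times A B) = nat_poly_val x A * nat_poly_val x B"
  by (induction A) (simp_all add: nat_poly_val_union nat_poly_val_image_plus algebra_simps)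

text \<open>The value of \<open>\<theta> \<partial>A/\<partial>\<theta>\<close>: unlike the derivative itself, this operator maps each monomial to a multiple
  of itself.\<close>

definition euler :: "('l \<Rightarrow> real) \<Rightarrow> 'l \<Rightarrow> 'l multiset multiset \<Rightarrow> real" where
  "euler x \<theta> A = (\<Sum>N\<in>#A. real (count N \<theta>) * label_val x N)"

lemma euler_empty [simp]: "euler x \<theta> {#} = 0"
  and euler_add_mset [simp]:
    "euler x \<theta> (add_mset N A) = real (count N \<theta>) * label_val x N + euler x \<theta> A"
  and euler_union: "euler x \<theta> (A + B) = euler x \<theta> A + euler x \<theta> B"
  by (simp_all add: euler_def)

lemma euler_image_plus:
  "euler x \<theta> (image_mset ((+) N) B) =
     real (count N \<theta>) * label_val x N * nat_poly_val x B + label_val x N * euler x \<theta> B"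
  by (induction B) (simp_all add: label_val_union algebra_simps)

lemma euler_product:
  "euler x \<theta> (nat_poly_times A B) = euler x \<theta> A * nat_poly_val x B + nat_poly_val x A * euler x \<theta> B"
  by (induction A) (simp_all add: euler_union euler_image_plus algebra_simps)

lemma euler_image_add_mset:
  "euler x \<theta> (image_mset (add_mset \<eta>) A) =
     x \<eta> * ((if \<eta> = \<theta> then nat_poly_val x A else 0) + euler x \<theta> A)"
  by (induction A) (auto simp: algebra_simps)

lemma nat_poly_val_image_add_mset:
  "nat_poly_val x (image_mset (add_mset \<eta>) A) = x \<eta> * nat_poly_val x A"
  by (induction A) (auto simp: algebra_simps)

lemma euler_eq_0: "(\<And>N. N \<in># A \<Longrightarrow> \<theta> \<notin># N) \<Longrightarrow> euler x \<theta> A = 0"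
  by (induction A) (auto simp: not_in_iff)

lemma nat_poly_val_sum: "nat_poly_val x (sum f A) = (\<Sum>a\<in>A. nat_poly_val x (f a))"
  by (induction A rule: infinite_finite_induct) (simp_all add: nat_poly_val_union)

lemma euler_sum: "euler x \<theta> (sum f A) = (\<Sum>a\<in>A. euler x \<theta> (f a))"
  by (induction A rule: infinite_finite_induct) (simp_all add: euler_union)

section \<open>Paths in plane trees\<close>

lemma subtree_append: "subtree T (u @ v) = subtree (subtree T u) v"
  by (induction u arbitrary: T) auto

lemma is_vertex_append: "is_vertex (u @ v) T \<longleftrightarrow> is_vertex u T \<and> is_vertex v (subtree T u)"
  by (induction u arbitrary: T) auto

lemma is_vertex_child: "is_vertex (u @ [i]) T \<longleftrightarrow> is_vertex u T \<and> i < length (out_labels T u)"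
  by (simp add: is_vertex_append out_labels_def)

lemma out_labels_Cons: "out_labels T (i # v) = out_labels (snd (branches T ! i)) v"
  by (simp add: out_labels_def)

lemma size_subtree_child:
  assumes "i < length (out_labels T u)"
  shows "size (subtree T (u @ [i])) < size (subtree T u)"
proof -
  obtain bs where bs: "subtree T u = Node bs"
    by (cases "subtree T u")
  have "size (snd b) < size (Node bs)" if "b \<in> set bs" for b
    using that by (induction bs) auto
  then show ?thesis
    using assms bs by (simp add: subtree_append out_labels_def)
qed

lemma size_subtree_append:
  assumes "is_vertex (u @ w) T" "w \<noteq> []"
  shows "size (subtree T (u @ w)) < size (subtree T u)"
  using assms
proof (induction w rule: rev_induct)
  case (snoc i w)
  then show ?case
    using size_subtree_child[of i T "u @ w"] is_vertex_child[of "u @ w" i T]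
    by (cases "w = []") auto
qed simp

primrec edge_labels :: "'l plane_tree \<Rightarrow> nat list \<Rightarrow> 'l list" where
  "edge_labels T [] = []"
| "edge_labels T (i # v) = fst (branches T ! i) # edge_labels (snd (branches T ! i)) v"

lemma leaf_paths_leaf: "branches S = [] \<Longrightarrow> leaf_paths S = [[]]"
  by (cases S) simp

lemma leaf_paths_inner:
  "branches S \<noteq> [] \<Longrightarrow>
   leaf_paths S = concat (map (\<lambda>b. map ((#) (fst b)) (leaf_paths (snd b))) (branches S))"
  by (cases S) (simp add: case_prod_unfold)

lemma leaf_paths_iff:
  "p \<in> set (leaf_paths S) \<longleftrightarrow> branches S = [] \<and> p = [] \<or>
     (\<exists>i<length (branches S). \<exists>q\<in>set (leaf_paths (snd (branches S ! i))).
        p = fst (branches S ! i) # q)"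
proof (cases "branches S = []")
  case False
  then show ?thesis
    by (fastforce simp: leaf_paths_inner in_set_conv_nth[of _ "branches S"])
qed (simp add: leaf_paths_leaf)

lemma leaf_paths_nonempty: "leaf_paths S \<noteq> []"
proof (induction S rule: leaf_paths.induct)
  case (1 bs)
  show ?case
  proof (cases "bs = []")
    case False
    then have "leaf_paths (snd (hd bs)) \<noteq> []"
      using 1[OF False, of "hd bs" "fst (hd bs)" "snd (hd bs)"] by simp
    with False show ?thesis
      by (cases bs) (auto simp: case_prod_unfold)
  qed simp
qed

lemma leaf_path_through:
  assumes "is_vertex v S" "i < length (out_labels S v)"
    and "q \<in> set (leaf_paths (subtree S (v @ [i])))"
  shows "edge_labels S v @ out_labels S v ! i # q \<in> set (leaf_paths S)"
  using assms
proof (induction v arbitrary: S)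
  case Nil
  then show ?case
    by (auto simp: out_labels_def leaf_paths_iff[of _ S])
next
  case (Cons k v)
  then show ?case
    by (auto simp: out_labels_Cons leaf_paths_iff[of _ S])
qed

text \<open>A label on a path comes from a vertex, so the stage structure can be applied to it.\<close>

lemma leaf_path_label_vertex:
  assumes "p \<in> set (leaf_paths S)" "\<theta> \<in> set p"
  obtains v i q where "is_vertex v S" "i < length (out_labels S v)" "out_labels S v ! i = \<theta>"
    and "q \<in> set (leaf_paths (subtree S (v @ [i])))" "p = edge_labels S v @ \<theta> # q"
  using assms
proof (induction p arbitrary: S thesis)
  case (Cons \<eta> p)
  obtain k where k: "k < length (branches S)" "\<eta> = fst (branches S ! k)"
    "p \<in> set (leaf_paths (snd (branches S ! k)))"
    using Cons.prems(2) by (auto simp: leaf_paths_iff[of _ S])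
  show ?case
  proof (cases "\<theta> = \<eta>")
    case True
    then show ?thesis
      using k by (intro Cons.prems(1)[of "[]" k p]) (auto simp: out_labels_def)
  next
    case False
    then have "\<theta> \<in> set p"
      using Cons.prems(3) by simp
    from Cons.IH[OF _ k(3) this] obtain v i q where v: "is_vertex v (snd (branches S ! k))"
      "i < length (out_labels (snd (branches S ! k)) v)"
      "out_labels (snd (branches S ! k)) v ! i = \<theta>"
      "q \<in> set (leaf_paths (subtree (snd (branches S ! k)) (v @ [i])))"
      "p = edge_labels (snd (branches S ! k)) v @ \<theta> # q"
      by blast
    then show ?thesis
      using k by (intro Cons.prems(1)[of "k # v" i q]) (auto simp: out_labels_Cons)
  qed
qed simp

definition path_monos :: "'l plane_tree \<Rightarrow> 'l multiset multiset" where
  "path_monos S = mset (map mset (leaf_paths S))"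

lemma in_path_monos_iff: "N \<in># path_monos S \<longleftrightarrow> (\<exists>p\<in>set (leaf_paths S). N = mset p)"
  by (auto simp: path_monos_def)

lemma path_monos_nonempty: "path_monos S \<noteq> {#}"
  by (simp add: path_monos_def leaf_paths_nonempty)

lemma path_monos_leaf: "out_labels T u = [] \<Longrightarrow> path_monos (subtree T u) = {#{#}#}"
  by (simp add: path_monos_def leaf_paths_leaf out_labels_def)

lemma path_monos_inner:
  assumes "out_labels T u \<noteq> []"
  shows "path_monos (subtree T u) = (\<Sum>i<length (out_labels T u).
           image_mset (add_mset (out_labels T u ! i)) (path_monos (subtree T (u @ [i]))))"
proof -
  let ?bs = "branches (subtree T u)"
  have "path_monos (subtree T u) =
      (\<Sum>b\<leftarrow>?bs. image_mset (add_mset (fst b)) (path_monos (snd b)))"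
    using assms by (simp add: path_monos_def leaf_paths_inner out_labels_def mset_concat map_concat o_def
        flip: mset_map)
  also have "\<dots> = (\<Sum>i<length ?bs. image_mset (add_mset (fst (?bs ! i))) (path_monos (snd (?bs ! i))))"
    by (simp add: sum_list_sum_nth atLeast0LessThan)
  finally show ?thesis
    by (simp add: out_labels_def subtree_append)
qed

lemma eval_interpolating_poly:
  "eval_poly x (interpolating_poly T u) = nat_poly_val x (path_monos (subtree T u))"
proof -
  have "(\<Sum>p\<leftarrow>ps. \<Prod>\<theta>\<leftarrow>p. x \<theta>) = nat_poly_val x (mset (map mset ps))" for ps
    by (induction ps) (simp_all add: label_val_mset)
  then show ?thesis
    by (simp add: interpolating_poly_def eval_poly_sum_list eval_poly_prod_list path_monos_def)
qed

section \<open>Exchanging labels in a balanced staged tree\<close>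

locale balanced_tree =
  fixes T :: "'l plane_tree" and sim :: "nat list rel"
  assumes staged: "staged_tree T sim"
    and balanced: "balanced T sim"
begin

lemma stage_vertices: "(u, v) \<in> sim \<Longrightarrow> is_vertex u T \<and> is_vertex v T"
  using staged by (auto simp: staged_tree_def equiv_def refl_on_def vertices_def)

lemma stage_refl: "is_vertex u T \<Longrightarrow> (u, u) \<in> sim"
  using staged by (auto simp: staged_tree_def equiv_def refl_on_def vertices_def)

lemma stage_sym: "(u, v) \<in> sim \<Longrightarrow> (v, u) \<in> sim"
  using staged by (auto simp: staged_tree_def equiv_def dest: symD)

lemma stage_trans: "(u, v) \<in> sim \<Longrightarrow> (v, w) \<in> sim \<Longrightarrow> (u, w) \<in> sim"
  using staged unfolding staged_tree_def equiv_def by (blast dest: transD)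

lemma stage_out_labels: "(u, v) \<in> sim \<Longrightarrow> out_labels T u = out_labels T v"
  using staged by (auto simp: staged_tree_def)

lemma distinct_out_labels: "is_vertex u T \<Longrightarrow> distinct (out_labels T u)"
  using staged by (cases "out_labels T u = []") (auto simp: staged_tree_def inner_vertices_def vertices_def)

text \<open>Labels of different stages are disjoint and those of a vertex are distinct, so a label determines
  the stage of its vertex and its position there.\<close>

lemma common_label:
  assumes "is_vertex u T" "is_vertex v T" "i < length (out_labels T u)" "j < length (out_labels T v)"
    and eq: "out_labels T u ! i = out_labels T v ! j"
  shows "(u, v) \<in> sim" "i = j"
proof -
  have "u \<in> inner_vertices T" "v \<in> inner_vertices T"
    using assms by (auto simp: inner_vertices_def vertices_def)
  moreover have "set (out_labels T u) \<inter> set (out_labels T v) \<noteq> {}"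
    using assms by (metis disjoint_iff nth_mem)
  ultimately show sim: "(u, v) \<in> sim"
    using staged unfolding staged_tree_def by blast
  show "i = j"
    using stage_out_labels[OF sim] distinct_out_labels[OF assms(2)] assms
    by (simp add: nth_eq_iff_index_eq)
qed

abbreviation monos_at :: "nat list \<Rightarrow> 'l multiset multiset" where
  "monos_at u \<equiv> path_monos (subtree T u)"

lemma balanced_nat_poly_val:
  assumes "(u, v) \<in> sim" "i < length (out_labels T u)" "j < length (out_labels T u)"
  shows "nat_poly_val x (monos_at (u @ [i])) * nat_poly_val x (monos_at (v @ [j])) =
         nat_poly_val x (monos_at (u @ [j])) * nat_poly_val x (monos_at (v @ [i]))"
proof -
  have "interpolating_poly T (u @ [i]) * interpolating_poly T (v @ [j]) =
        interpolating_poly T (u @ [j]) * interpolating_poly T (v @ [i])"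
    using balanced assms unfolding balanced_def by blast
  then show ?thesis
    by (metis eval_poly_mult eval_interpolating_poly)
qed

text \<open>Balancedness as an identity of multisets, from which exchanges of labels are read off.\<close>

lemma balanced_product:
  assumes "(u, v) \<in> sim" "i < length (out_labels T u)" "j < length (out_labels T u)"
  shows "nat_poly_times (monos_at (u @ [i])) (monos_at (v @ [j])) =
         nat_poly_times (monos_at (u @ [j])) (monos_at (v @ [i]))"
  by (rule nat_poly_val_inject) (simp add: nat_poly_val_product balanced_nat_poly_val[OF assms])

text \<open>The monomial \<open>p q\<close> of \<open>t(u\<^sub>i) t(v\<^sub>j)\<close> occurs in \<open>t(u\<^sub>j) t(v\<^sub>i)\<close> as well.\<close>

lemma exchange_between_paths:
  assumes "(u, v) \<in> sim" "i < length (out_labels T u)" "j < length (out_labels T u)"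
    and "p \<in> set (leaf_paths (subtree T (u @ [i])))" "q \<in> set (leaf_paths (subtree T (v @ [j])))"
  obtains p' q' where "p' \<in> set (leaf_paths (subtree T (u @ [j])))"
    and "q' \<in> set (leaf_paths (subtree T (v @ [i])))" and "mset p + mset q = mset p' + mset q'"
proof -
  have "mset p + mset q \<in># nat_poly_times (monos_at (u @ [i])) (monos_at (v @ [j]))"
    using assms(4,5) unfolding in_nat_poly_times_iff
    by (intro bexI[of _ "mset p"] bexI[of _ "mset q"]) (auto simp: in_path_monos_iff)
  then show thesis
    using that unfolding balanced_product[OF assms(1-3)]
    by (auto simp: in_nat_poly_times_iff in_path_monos_iff)
qed

text \<open>The derivation \<open>c\<^sub>j \<partial>/\<partial>\<theta>\<^sub>i - c\<^sub>i \<partial>/\<partial>\<theta>\<^sub>j\<close> annihilates \<open>t(w)\<close>; the statement is this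
  equation multiplied by \<open>\<theta>\<^sub>i\<theta>\<^sub>j\<close>. In the expansion \<open>t(w) = \<Sum> \<theta>\<^sub>l t(w\<^sub>l)\<close> the
  children contribute nothing by induction, and the derivatives of the labels at \<open>w\<close> itself
  contribute only if \<open>w\<close> lies in the stage of \<open>v\<close>; then they give \<open>c\<^sub>j t(w\<^sub>i) - c\<^sub>i t(w\<^sub>j)\<close>, which
  vanishes by balancedness. Conceptually, \<open>t(w)\<close> depends on the labels of the stage through the single
  form \<open>\<Sum> c\<^sub>l \<theta>\<^sub>l\<close>.\<close>

lemma euler_proportional:
  fixes x :: "'l \<Rightarrow> real"
  assumes "is_vertex v T" "i < length (out_labels T v)" "j < length (out_labels T v)"
    and "is_vertex w T"
  defines "c \<equiv> \<lambda>l. nat_poly_val x (monos_at (v @ [l]))" and "\<theta> \<equiv> \<lambda>l. out_labels T v ! l"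
  shows "c j * x (\<theta> j) * euler x (\<theta> i) (monos_at w) = c i * x (\<theta> i) * euler x (\<theta> j) (monos_at w)"
  using \<open>is_vertex w T\<close>
proof (induction "size (subtree T w)" arbitrary: w rule: less_induct)
  case less
  let ?n = "length (out_labels T w)"
  let ?e = "out_labels T w"
  show ?case
  proof (cases "?e = []")
    case True
    then show ?thesis
      by (simp add: path_monos_leaf)
  next
    case False
    have IH: "c j * x (\<theta> j) * euler x (\<theta> i) (monos_at (w @ [l])) =
              c i * x (\<theta> i) * euler x (\<theta> j) (monos_at (w @ [l]))" if "l < ?n" for l
      using less that by (simp add: size_subtree_child is_vertex_child)
    \<comment> \<open>The part of the derivative that comes from the labels at \<open>w\<close>.\<close>
    define own where "own k = (\<Sum>l<?n. x (?e ! l) *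
       (if ?e ! l = \<theta> k then nat_poly_val x (monos_at (w @ [l])) else 0))" for k
    have split: "euler x (\<theta> k) (monos_at w) =
        own k + (\<Sum>l<?n. x (?e ! l) * euler x (\<theta> k) (monos_at (w @ [l])))" for k
      by (simp add: path_monos_inner[OF False] euler_sum euler_image_add_mset own_def
          distrib_left sum.distrib)
    have "c j * x (\<theta> j) * own i = c i * x (\<theta> i) * own j"
    proof (cases "(v, w) \<in> sim")
      case True
      then have same: "out_labels T v = ?e"
        by (rule stage_out_labels)
      have own: "own k = x (\<theta> k) * nat_poly_val x (monos_at (w @ [k]))" if "k < ?n" for k
      proof -
        have "own k = (\<Sum>l<?n. if l = k then x (\<theta> k) * nat_poly_val x (monos_at (w @ [k])) else 0)"
          unfolding own_def \<theta>_def same using that distinct_out_labels[OF less.prems]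
          by (intro sum.cong) (auto simp: nth_eq_iff_index_eq)
        then show ?thesis
          using that by simp
      qed
      have "c i * nat_poly_val x (monos_at (w @ [j])) = c j * nat_poly_val x (monos_at (w @ [i]))"
        unfolding c_def by (rule balanced_nat_poly_val[OF True assms(2,3)])
      then show ?thesis
        using own[of i] own[of j] assms(2,3) same by (simp add: algebra_simps)
    next
      case False
      then have "?e ! l \<noteq> \<theta> k" if "l < ?n" "k < length (out_labels T v)" for k l
        using common_label(1)[OF assms(1) less.prems that(2,1)] unfolding \<theta>_def by force
      then have "own k = 0" if "k < length (out_labels T v)" for k
        using that by (simp add: own_def)
      then show ?thesis
        using assms(2,3) by simp
    qed
    moreover have "c j * x (\<theta> j) * (\<Sum>l<?n. x (?e ! l) * euler x (\<theta> i) (monos_at (w @ [l]))) =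
          c i * x (\<theta> i) * (\<Sum>l<?n. x (?e ! l) * euler x (\<theta> j) (monos_at (w @ [l])))"
      unfolding sum_distrib_left
    proof (intro sum.cong refl)
      fix l assume "l \<in> {..<?n}"
      then show "c j * x (\<theta> j) * (x (?e ! l) * euler x (\<theta> i) (monos_at (w @ [l]))) =
                 c i * x (\<theta> i) * (x (?e ! l) * euler x (\<theta> j) (monos_at (w @ [l])))"
        using IH[of l] by (simp add: algebra_simps)
    qed
    ultimately show ?thesis
      by (simp add: split distrib_left)
  qed
qed

text \<open>A vertex of the stage with the fewest nodes below it has no vertex of its stage below it, so the
  interpolating polynomials of its children are constant in the labels of the stage.\<close>

lemma lowest_in_stage:
  assumes "is_vertex u T"
  obtains v where "(u, v) \<in> sim"
    and "\<And>l p. l < length (out_labels T v) \<Longrightarrow> p \<in> set (leaf_paths (subtree T (v @ [l]))) \<Longrightarrow>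
           set p \<inter> set (out_labels T v) = {}"
proof -
  obtain v where v: "(u, v) \<in> sim" and
    least: "\<And>w. (u, w) \<in> sim \<Longrightarrow> size (subtree T v) \<le> size (subtree T w)"
    using ex_has_least_nat[of "\<lambda>v. (u, v) \<in> sim" u "\<lambda>v. size (subtree T v)"] stage_refl[OF assms]
    by blast
  have "set p \<inter> set (out_labels T v) = {}"
    if l: "l < length (out_labels T v)" and p: "p \<in> set (leaf_paths (subtree T (v @ [l])))" for l p
  proof (rule ccontr)
    assume "set p \<inter> set (out_labels T v) \<noteq> {}"
    then obtain j where j: "j < length (out_labels T v)" "out_labels T v ! j \<in> set p"
      by (metis disjoint_iff in_set_conv_nth)
    from leaf_path_label_vertex[OF p j(2)] obtain w i where w: "is_vertex w (subtree T (v @ [l]))"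
      "i < length (out_labels (subtree T (v @ [l])) w)"
      "out_labels (subtree T (v @ [l])) w ! i = out_labels T v ! j"
      by metis
    let ?w = "(v @ [l]) @ w"
    have vtx: "is_vertex ?w T"
      using v l w(1) by (simp only: is_vertex_append[of "v @ [l]"] is_vertex_child) (blast dest: stage_vertices)
    have lab: "out_labels (subtree T (v @ [l])) w = out_labels T ?w"
      by (simp only: out_labels_def subtree_append)
    have "(?w, v) \<in> sim"
      using common_label(1)[OF vtx _ _ j(1), of i] w lab stage_vertices[OF v] by auto
    then have "size (subtree T v) \<le> size (subtree T ?w)"
      using least v stage_sym stage_trans by blast
    moreover have "size (subtree T ?w) < size (subtree T v)"
      using size_subtree_append[of v "l # w" T] vtx by simp
    ultimately show False
      by simp
  qed
  with v that show thesis
    by blast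
qed

text \<open>The monomials of \<open>\<theta>\<^sub>i\<theta>\<^sub>j \<partial>t(u\<^sub>i)/\<partial>\<theta>\<^sub>j = \<theta>\<^sub>i\<theta>\<^sub>j \<partial>t(u\<^sub>j)/\<partial>\<theta>\<^sub>i\<close>, compared. With \<open>c\<^sub>l\<close> taken at a lowest vertex of the
  stage, applying \<open>\<partial>/\<partial>\<theta>\<^sub>i\<close> to \<open>t(u\<^sub>i) c\<^sub>j = t(u\<^sub>j) c\<^sub>i\<close> does not touch the \<open>c\<^sub>l\<close>; combining the result with
  \<open>c\<^sub>j \<partial>t(u\<^sub>i)/\<partial>\<theta>\<^sub>i = c\<^sub>i \<partial>t(u\<^sub>i)/\<partial>\<theta>\<^sub>j\<close> and cancelling \<open>c\<^sub>i\<close> gives the identity.\<close>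

lemma exchange_within_path:
  assumes u: "is_vertex u T" "i < length (out_labels T u)" "j < length (out_labels T u)"
    and p: "p \<in> set (leaf_paths (subtree T (u @ [i])))" "out_labels T u ! j \<in> set p"
  obtains q where "q \<in> set (leaf_paths (subtree T (u @ [j])))"
    and "add_mset (out_labels T u ! i) (mset p) = add_mset (out_labels T u ! j) (mset q)"
proof -
  let ?\<theta> = "\<lambda>l. out_labels T u ! l"
  obtain v where v: "(u, v) \<in> sim" and
    free: "\<And>l p. l < length (out_labels T v) \<Longrightarrow> p \<in> set (leaf_paths (subtree T (v @ [l]))) \<Longrightarrow>
             set p \<inter> set (out_labels T v) = {}"
    using lowest_in_stage[OF u(1)] by metis
  have same: "out_labels T v = out_labels T u"
    using stage_out_labels[OF v] by simp
  have v': "is_vertex v T" "i < length (out_labels T v)" "j < length (out_labels T v)"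
    using stage_vertices[OF v] u same by auto
  \<comment> \<open>The polynomial \<open>\<theta>\<^sub>k\<theta>\<^sub>l \<partial>t(u\<^sub>k)/\<partial>\<theta>\<^sub>l\<close>: each monomial of \<open>\<theta>\<^sub>k t(u\<^sub>k)\<close>, as often as \<open>\<theta>\<^sub>l\<close> occurs in its
    factor from \<open>t(u\<^sub>k)\<close>.\<close>
  define weighted where "weighted k l =
    (\<Sum>N\<in>#monos_at (u @ [k]). replicate_mset (count N (?\<theta> l)) (add_mset (?\<theta> k) N))" for k l
  have weighted_val: "nat_poly_val x (weighted k l) = x (?\<theta> k) * euler x (?\<theta> l) (monos_at (u @ [k]))" for x k l
  proof -
    have rep: "nat_poly_val x (replicate_mset n N) = n * label_val x N" for n :: nat and N
      by (induction n) (simp_all add: algebra_simps)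
    have "nat_poly_val x (\<Sum>N\<in>#A. replicate_mset (count N (?\<theta> l)) (add_mset (?\<theta> k) N)) =
          x (?\<theta> k) * euler x (?\<theta> l) A" for A
      by (induction A) (simp_all add: nat_poly_val_union rep algebra_simps)
    then show ?thesis
      by (simp add: weighted_def)
  qed
  have "weighted i j = weighted j i"
  proof (rule nat_poly_val_inject)
    fix x :: "'l \<Rightarrow> real" assume x: "\<And>\<theta>. x \<theta> > 0"
    define c where "c l = nat_poly_val x (monos_at (v @ [l]))" for l
    have "c i > 0"
      unfolding c_def using x path_monos_nonempty by (rule nat_poly_val_pos)
    have proportional: "c j * x (?\<theta> j) * euler x (?\<theta> i) (monos_at (u @ [i])) =
          c i * x (?\<theta> i) * euler x (?\<theta> j) (monos_at (u @ [i]))"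
      using euler_proportional[OF v', of "u @ [i]" x] u by (simp add: c_def same is_vertex_child)
    have "euler x (?\<theta> i) (monos_at (v @ [l])) = 0" if "l < length (out_labels T v)" for l
      using free[OF that] nth_mem[OF u(2)] same
      by (intro euler_eq_0) (fastforce simp: in_path_monos_iff disjoint_iff)
    then have exchanged:
      "euler x (?\<theta> i) (monos_at (u @ [i])) * c j = euler x (?\<theta> i) (monos_at (u @ [j])) * c i"
      using arg_cong[OF balanced_product[OF v u(2,3)], of "euler x (?\<theta> i)"] v'
      by (simp add: euler_product c_def)
    have "c i * (x (?\<theta> i) * euler x (?\<theta> j) (monos_at (u @ [i]))) =
          x (?\<theta> j) * (euler x (?\<theta> i) (monos_at (u @ [i])) * c j)"
      using proportional by (simp add: ac_simps)
    also have "\<dots> = c i * (x (?\<theta> j) * euler x (?\<theta> i) (monos_at (u @ [j])))"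
      unfolding exchanged by (simp add: ac_simps)
    finally show "nat_poly_val x (weighted i j) = nat_poly_val x (weighted j i)"
      using \<open>c i > 0\<close> by (simp add: weighted_val)
  qed
  moreover have "add_mset (?\<theta> i) (mset p) \<in># weighted i j"
    using p by (auto simp: weighted_def in_path_monos_iff intro!: bexI[of _ p])
  ultimately show thesis
    using that by (auto simp: weighted_def in_path_monos_iff split: if_splits)
qed

end

section \<open>The order of the leaves\<close>

primrec before :: "'a list \<Rightarrow> 'a \<Rightarrow> 'a \<Rightarrow> bool" where
  "before [] p q \<longleftrightarrow> False"
| "before (x # xs) p q \<longleftrightarrow> x = p \<and> q \<in> set xs \<or> before xs p q"

lemma before_set: "before xs p q \<Longrightarrow> p \<in> set xs \<and> q \<in> set xs"
  by (induction xs) auto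

lemma before_append:
  "before (xs @ ys) p q \<longleftrightarrow> before xs p q \<or> before ys p q \<or> p \<in> set xs \<and> q \<in> set ys"
  by (induction xs) auto

lemma before_map: "before (map f xs) p q \<longleftrightarrow> (\<exists>p' q'. before xs p' q' \<and> p = f p' \<and> q = f q')"
  by (induction xs) auto

lemma before_concat:
  "before (concat xss) p q \<longleftrightarrow> (\<exists>k<length xss. before (xss ! k) p q) \<or>
     (\<exists>j<length xss. \<exists>i<j. p \<in> set (xss ! i) \<and> q \<in> set (xss ! j))"
proof (induction xss)
  case (Cons xs xss)
  have "q \<in> set (concat xss) \<longleftrightarrow> (\<exists>j<length xss. q \<in> set (xss ! j))"
    by (auto simp: Bex_def in_set_conv_nth[of _ xss])
  then show ?case
    by (simp only: concat.simps before_append Cons.IH length_Cons Ex_less_Suc2)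
      (auto simp: Ex_less_Suc2)
qed simp

lemma before_iff_nth: "before xs p q \<longleftrightarrow> (\<exists>s<length xs. \<exists>r<s. xs ! r = p \<and> xs ! s = q)"
proof -
  have "before (concat (map (\<lambda>x. [x]) xs)) p q \<longleftrightarrow>
      (\<exists>s<length xs. \<exists>r<s. p \<in> set (map (\<lambda>x. [x]) xs ! r) \<and> q \<in> set (map (\<lambda>x. [x]) xs ! s))"
    unfolding before_concat by auto
  also have "\<dots> \<longleftrightarrow> (\<exists>s<length xs. \<exists>r<s. xs ! r = p \<and> xs ! s = q)"
  proof -
    have "p \<in> set (map (\<lambda>x. [x]) xs ! r) \<and> q \<in> set (map (\<lambda>x. [x]) xs ! s) \<longleftrightarrow> xs ! r = p \<and> xs ! s = q"
      if "s < length xs" "r < s" for r s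
      using that by auto
    then show ?thesis
      by blast
  qed
  finally show ?thesis
    by simp
qed

lemma distinct_iff_not_before: "distinct xs \<longleftrightarrow> (\<forall>p. \<not> before xs p p)"
  by (induction xs) auto

text \<open>The order of the leaves is decided where their paths separate. Together with the converse,
  \<open>leaf_paths_before\<close>, this turns comparisons of leaf numbers into comparisons of child positions.\<close>

lemma leaf_paths_diverge:
  assumes "before (leaf_paths S) p q"
  obtains u i j p' q' where "is_vertex u S" "i < j" "j < length (out_labels S u)"
    and "p' \<in> set (leaf_paths (subtree S (u @ [i])))" "q' \<in> set (leaf_paths (subtree S (u @ [j])))"
    and "p = edge_labels S u @ out_labels S u ! i # p'" "q = edge_labels S u @ out_labels S u ! j # q'"
  using assms
proof (induction "length p" arbitrary: S p q thesis rule: less_induct)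
  case less
  let ?bs = "branches S"
  have inner: "?bs \<noteq> []"
    using less.prems(2) leaf_paths_leaf[of S] by auto
  consider (same) k where "k < length ?bs"
      "before (map ((#) (fst (?bs ! k))) (leaf_paths (snd (?bs ! k)))) p q"
    | (root) i j where "i < j" "j < length ?bs"
      "p \<in> (#) (fst (?bs ! i)) ` set (leaf_paths (snd (?bs ! i)))"
      "q \<in> (#) (fst (?bs ! j)) ` set (leaf_paths (snd (?bs ! j)))"
    using less.prems(2) unfolding leaf_paths_inner[OF inner] before_concat by auto
  then show thesis
  proof cases
    case same
    then obtain p1 q1 where pq: "p = fst (?bs ! k) # p1" "q = fst (?bs ! k) # q1"
      "before (leaf_paths (snd (?bs ! k))) p1 q1"
      by (auto simp: before_map)
    show thesis
    proof (rule less.hyps[OF _ _ pq(3)])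
      show "length p1 < length p"
        by (simp add: pq)
      fix u i j p' q'
      assume "is_vertex u (snd (?bs ! k))" "i < j" "j < length (out_labels (snd (?bs ! k)) u)"
        and "p' \<in> set (leaf_paths (subtree (snd (?bs ! k)) (u @ [i])))"
          "q' \<in> set (leaf_paths (subtree (snd (?bs ! k)) (u @ [j])))"
        and "p1 = edge_labels (snd (?bs ! k)) u @ out_labels (snd (?bs ! k)) u ! i # p'"
          "q1 = edge_labels (snd (?bs ! k)) u @ out_labels (snd (?bs ! k)) u ! j # q'"
      with same pq show thesis
        by (intro less.prems(1)[of "k # u" i j p' q']) (auto simp: out_labels_Cons)
    qed
  next
    case root
    then show thesis
      by (auto simp: out_labels_def intro!: less.prems(1)[of "[]" i j])
  qed
qed

lemma leaf_paths_before:
  assumes "is_vertex u S" "i < j" "j < length (out_labels S u)"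
    and "p \<in> set (leaf_paths (subtree S (u @ [i])))" "q \<in> set (leaf_paths (subtree S (u @ [j])))"
  shows "before (leaf_paths S) (edge_labels S u @ out_labels S u ! i # p)
           (edge_labels S u @ out_labels S u ! j # q)"
  using assms
proof (induction u arbitrary: S)
  case Nil
  then have "branches S \<noteq> []"
    by (auto simp: out_labels_def)
  with Nil show ?case
    by (fastforce simp: leaf_paths_inner before_concat out_labels_def)
next
  case (Cons k u)
  let ?b = "branches S ! k"
  have inner: "branches S \<noteq> []" and k: "k < length (branches S)"
    using Cons.prems(1) by auto
  have "before (leaf_paths (snd ?b)) (edge_labels (snd ?b) u @ out_labels (snd ?b) u ! i # p)
           (edge_labels (snd ?b) u @ out_labels (snd ?b) u ! j # q)"
    using Cons.prems by (intro Cons.IH) (auto simp: out_labels_Cons)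
  then show ?case
    unfolding leaf_paths_inner[OF inner] before_concat
    using k by (intro disjI1 exI[of _ k]) (auto simp: before_map out_labels_Cons)
qed

context balanced_tree
begin

text \<open>If a path were listed twice, its two occurrences would separate at two different edges with the
  same label.\<close>

lemma distinct_leaf_paths: "distinct (leaf_paths T)"
  unfolding distinct_iff_not_before
proof (intro allI notI)
  fix p assume "before (leaf_paths T) p p"
  then show False
  proof (rule leaf_paths_diverge)
    fix u i j p' q'
    assume "is_vertex u T" "i < j" "j < length (out_labels T u)"
      and "p = edge_labels T u @ out_labels T u ! i # p'" "p = edge_labels T u @ out_labels T u ! j # q'"
    then show False
      using distinct_out_labels[of u] by (auto simp: nth_eq_iff_index_eq)
  qed
qed

abbreviation leaf_numbers :: "nat set" where
  "leaf_numbers \<equiv> {1..num_leaves T}"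

lemma leaf_path_in: "r \<in> leaf_numbers \<Longrightarrow> leaf_path T r \<in> set (leaf_paths T)"
  by (auto simp: leaf_path_def num_leaves_def)

lemma leaf_number_exists:
  assumes "p \<in> set (leaf_paths T)"
  obtains r where "r \<in> leaf_numbers" "leaf_path T r = p"
proof -
  obtain k where "k < length (leaf_paths T)" "leaf_paths T ! k = p"
    using assms by (auto simp: in_set_conv_nth)
  then show thesis
    using that[of "Suc k"] by (simp add: leaf_path_def num_leaves_def)
qed

lemma before_leaf_path_iff:
  assumes "r \<in> leaf_numbers" "s \<in> leaf_numbers"
  shows "before (leaf_paths T) (leaf_path T r) (leaf_path T s) \<longleftrightarrow> r < s"
proof -
  have range: "r - 1 < length (leaf_paths T)" "s - 1 < length (leaf_paths T)"
    using assms by (auto simp: num_leaves_def)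
  have "before (leaf_paths T) (leaf_path T r) (leaf_path T s) \<longleftrightarrow> r - 1 < s - 1"
  proof
    assume "before (leaf_paths T) (leaf_path T r) (leaf_path T s)"
    then obtain k l where kl: "l < length (leaf_paths T)" "k < l"
      "leaf_paths T ! k = leaf_paths T ! (r - 1)" "leaf_paths T ! l = leaf_paths T ! (s - 1)"
      unfolding before_iff_nth leaf_path_def by blast
    then have "k = r - 1" "l = s - 1"
      using range nth_eq_iff_index_eq[OF distinct_leaf_paths, of k "r - 1"]
        nth_eq_iff_index_eq[OF distinct_leaf_paths, of l "s - 1"] by simp_all
    with \<open>k < l\<close> show "r - 1 < s - 1"
      by simp
  next
    assume "r - 1 < s - 1"
    with range show "before (leaf_paths T) (leaf_path T r) (leaf_path T s)"
      unfolding before_iff_nth leaf_path_def by blast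
  qed
  then show ?thesis
    using assms by auto
qed

lemma leaves_diverge:
  assumes "r \<in> leaf_numbers" "s \<in> leaf_numbers" "r < s"
  obtains u i j p q where "is_vertex u T" "i < j" "j < length (out_labels T u)"
    and "p \<in> set (leaf_paths (subtree T (u @ [i])))" "q \<in> set (leaf_paths (subtree T (u @ [j])))"
    and "leaf_path T r = edge_labels T u @ out_labels T u ! i # p"
    and "leaf_path T s = edge_labels T u @ out_labels T u ! j # q"
  using assms before_leaf_path_iff[OF assms(1,2)] leaf_paths_diverge by metis

lemma later_leaf:
  assumes "r \<in> leaf_numbers" "is_vertex u T" "i < j" "j < length (out_labels T u)"
    and "leaf_path T r = edge_labels T u @ out_labels T u ! i # p"
    and "p \<in> set (leaf_paths (subtree T (u @ [i])))" "q \<in> set (leaf_paths (subtree T (u @ [j])))"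
  obtains s where "s \<in> leaf_numbers" "r < s" "leaf_path T s = edge_labels T u @ out_labels T u ! j # q"
proof -
  have "before (leaf_paths T) (leaf_path T r) (edge_labels T u @ out_labels T u ! j # q)"
    unfolding assms(5) using assms by (intro leaf_paths_before)
  moreover from this have "edge_labels T u @ out_labels T u ! j # q \<in> set (leaf_paths T)"
    using before_set by metis
  then obtain s where "s \<in> leaf_numbers" "leaf_path T s = edge_labels T u @ out_labels T u ! j # q"
    by (rule leaf_number_exists)
  ultimately show thesis
    using that before_leaf_path_iff[OF assms(1)] by metis
qed

section \<open>Reducing a monomial by a quadratic binomial\<close>

abbreviation leaf_mono :: "nat \<Rightarrow> 'l multiset" where
  "leaf_mono r \<equiv> mset (leaf_path T r)"

text \<open>The kept indices, described by path labels instead of by \<open>\<phi>\<close>; the two descriptions agree by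
  \<open>kept_indices_eq\<close>.\<close>

definition last_leaves :: "nat set" where
  "last_leaves = {r \<in> leaf_numbers. \<not> (\<exists>s\<in>leaf_numbers. s > r \<and> leaf_mono r = leaf_mono s)}"

lemma last_leaf_exists:
  assumes "r \<in> leaf_numbers"
  obtains s where "s \<in> last_leaves" "r \<le> s" "leaf_mono s = leaf_mono r"
proof -
  let ?A = "{s \<in> leaf_numbers. leaf_mono s = leaf_mono r}"
  have fin: "finite ?A" and r: "r \<in> ?A"
    using assms by auto
  have "Max ?A \<in> ?A"
    using fin r by (intro Max_in) auto
  moreover have "\<not> (\<exists>s\<in>leaf_numbers. s > Max ?A \<and> leaf_mono (Max ?A) = leaf_mono s)"
  proof (intro notI, elim bexE conjE)
    fix s assume "s \<in> leaf_numbers" "s > Max ?A" "leaf_mono (Max ?A) = leaf_mono s"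
    then have "s \<in> ?A"
      using \<open>Max ?A \<in> ?A\<close> by simp
    with fin have "s \<le> Max ?A"
      by (rule Max_ge)
    with \<open>s > Max ?A\<close> show False
      by simp
  qed
  ultimately show thesis
    using that[of "Max ?A"] Max_ge[OF fin r] by (simp add: last_leaves_def)
qed

definition label_content :: "(nat \<Rightarrow>\<^sub>0 nat) \<Rightarrow> 'l multiset" where
  "label_content m = (\<Sum>r\<in>Poly_Mapping.keys m. repeat_mset (Poly_Mapping.lookup m r) (leaf_mono r))"

lemma count_label_content:
  "count (label_content m) \<theta> =
     (\<Sum>r\<in>Poly_Mapping.keys m. Poly_Mapping.lookup m r * count (leaf_mono r) \<theta>)"
  by (simp add: label_content_def count_sum)

end

text \<open>The higher indices contribute equally to both sides and \<open>i\<close> contributes at least \<open>h i\<close> more on the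
  right, so the lower indices have to make up for it on the left. With \<open>h = 1\<close> this provides a lower
  index, and with label counts it provides occurrences of a label.\<close>

lemma weight_below_first_excess:
  fixes m m' :: "nat \<Rightarrow>\<^sub>0 nat" and h :: "nat \<Rightarrow> nat"
  assumes eq: "(\<Sum>r\<in>Poly_Mapping.keys m. Poly_Mapping.lookup m r * h r) =
               (\<Sum>r\<in>Poly_Mapping.keys m'. Poly_Mapping.lookup m' r * h r)"
    and i: "Poly_Mapping.lookup m i < Poly_Mapping.lookup m' i"
    and above: "\<And>j. j > i \<Longrightarrow> Poly_Mapping.lookup m j = Poly_Mapping.lookup m' j"
  shows "h i \<le> (\<Sum>r\<in>{r \<in> Poly_Mapping.keys m. r < i}. Poly_Mapping.lookup m r * h r)"
proof -
  define A where "A = Poly_Mapping.keys m \<union> Poly_Mapping.keys m' \<union> {i}"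
  have A: "finite A" "Poly_Mapping.keys m \<subseteq> A" "Poly_Mapping.keys m' \<subseteq> A" "i \<in> A"
    by (auto simp: A_def)
  have extend: "(\<Sum>r\<in>Poly_Mapping.keys k. Poly_Mapping.lookup k r * h r) =
      (\<Sum>r\<in>A. Poly_Mapping.lookup k r * h r)" if "Poly_Mapping.keys k \<subseteq> A" for k
    using A that by (intro sum.mono_neutral_left) (auto simp: in_keys_iff)
  have split: "(\<Sum>r\<in>A. f r) = (\<Sum>r\<in>{r\<in>A. r < i}. f r) + f i + (\<Sum>r\<in>{r\<in>A. r > i}. f r)"
    for f :: "nat \<Rightarrow> nat"
  proof -
    have "A = {r\<in>A. r < i} \<union> ({i} \<union> {r\<in>A. r > i})"
      using A by auto
    then have "(\<Sum>r\<in>A. f r) = (\<Sum>r\<in>{r\<in>A. r < i} \<union> ({i} \<union> {r\<in>A. r > i}). f r)"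
      by simp
    also have "\<dots> = (\<Sum>r\<in>{r\<in>A. r < i}. f r) + (\<Sum>r\<in>{i} \<union> {r\<in>A. r > i}. f r)"
      using A by (intro sum.union_disjoint) auto
    finally show ?thesis
      using A by simp
  qed
  have "(\<Sum>r\<in>{r\<in>A. r > i}. Poly_Mapping.lookup m r * h r) =
        (\<Sum>r\<in>{r\<in>A. r > i}. Poly_Mapping.lookup m' r * h r)"
    by (intro sum.cong) (auto simp: above)
  then have "(\<Sum>r\<in>{r\<in>A. r < i}. Poly_Mapping.lookup m r * h r) + Poly_Mapping.lookup m i * h i \<ge>
        Poly_Mapping.lookup m' i * h i"
    using eq by (simp add: extend A split)
  moreover have "Poly_Mapping.lookup m' i * h i \<ge> Poly_Mapping.lookup m i * h i + h i"
    using mult_le_mono1[of "Suc (Poly_Mapping.lookup m i)" "Poly_Mapping.lookup m' i" "h i"] i by simp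
  moreover have "(\<Sum>r\<in>{r\<in>A. r < i}. Poly_Mapping.lookup m r * h r) =
        (\<Sum>r\<in>{r \<in> Poly_Mapping.keys m. r < i}. Poly_Mapping.lookup m r * h r)"
    using A by (intro sum.mono_neutral_right) (auto simp: in_keys_iff)
  ultimately show ?thesis
    by simp
qed

context balanced_tree
begin

text \<open>In \<open>m\<close>, the larger of two monomials with equal image, some quadratic factor \<open>p\<^sub>a p\<^sub>c\<close> has the same
  image as a pair that reaches a higher index, and so is the leading term of a binomial in the kernel.
  The choice of \<open>a\<close> as the highest occurring leaf below \<open>b\<close> ensures that \<open>a'\<close> exceeds \<open>c\<close> too.\<close>

lemma pair_moves_up:
  assumes gt: "drl_gt m m'" and deg: "mon_degree m = mon_degree m'"
    and content: "label_content m = label_content m'"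
    and m: "Poly_Mapping.keys m \<subseteq> last_leaves" and m': "Poly_Mapping.keys m' \<subseteq> leaf_numbers"
  obtains a c a' c' where "a \<in> Poly_Mapping.keys m" "c \<in> Poly_Mapping.keys m"
    and "a = c \<longrightarrow> Poly_Mapping.lookup m a \<ge> 2"
    and "a' \<in> last_leaves" "c' \<in> last_leaves" "c \<le> a" "a < a'"
    and "leaf_mono a + leaf_mono c = leaf_mono a' + leaf_mono c'"
proof -
  let ?l = "Poly_Mapping.lookup"
  obtain b where b: "?l m b < ?l m' b" and above: "\<And>j. j > b \<Longrightarrow> ?l m j = ?l m' j"
    using gt deg by (auto simp: drl_gt_def)
  define X where "X = {r \<in> Poly_Mapping.keys m. r < b}"
  have below: "h b \<le> (\<Sum>r\<in>X. ?l m r * h r)" if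
    "(\<Sum>r\<in>Poly_Mapping.keys m. ?l m r * h r) = (\<Sum>r\<in>Poly_Mapping.keys m'. ?l m' r * h r)" for h
    unfolding X_def using that b above by (rule weight_below_first_excess)
  have "1 \<le> (\<Sum>r\<in>X. ?l m r)"
    using below[of "\<lambda>_. 1"] deg by (simp add: mon_degree_def)
  then have X: "finite X" "X \<noteq> {}"
    by (auto simp del: Collect_empty_eq) (simp add: X_def)
  define a where "a = Max X"
  have a: "a \<in> X" and a_max: "\<And>c. c \<in> X \<Longrightarrow> c \<le> a"
    using X by (simp_all add: a_def)
  have a_last: "a \<in> last_leaves" and "a < b"
    using a m by (auto simp: X_def)
  have a_leaf: "a \<in> leaf_numbers"
    using a_last by (simp add: last_leaves_def)
  have b_leaf: "b \<in> leaf_numbers"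
    using b m' by (metis gr_implies_not0 in_keys_iff subsetD)
  obtain u i j p q where u: "is_vertex u T" "i < j" "j < length (out_labels T u)"
    and p: "p \<in> set (leaf_paths (subtree T (u @ [i])))"
    and q: "q \<in> set (leaf_paths (subtree T (u @ [j])))"
    and a_path: "leaf_path T a = edge_labels T u @ out_labels T u ! i # p"
    and b_path: "leaf_path T b = edge_labels T u @ out_labels T u ! j # q"
    using leaves_diverge[OF a_leaf b_leaf \<open>a < b\<close>] by metis
  define \<theta> where "\<theta> = out_labels T u ! j"
  have i: "i < length (out_labels T u)" and \<theta>_i: "out_labels T u ! i \<noteq> \<theta>"
    using u distinct_out_labels[OF u(1)] by (auto simp: \<theta>_def nth_eq_iff_index_eq)
  define h where "h r = count (leaf_mono r) \<theta>" for r
  have needed: "h b \<le> (\<Sum>r\<in>X. ?l m r * h r)"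
    unfolding h_def using arg_cong[OF content, of "\<lambda>N. count N \<theta>"]
    by (intro below) (simp add: count_label_content)
  have h_b: "h b \<ge> count (mset (edge_labels T u)) \<theta> + 1"
    by (simp add: h_def b_path \<theta>_def)
  \<comment> \<open>A square \<open>p\<^sub>a\<^sup>2\<close> counts as two factors, each of which may supply the label.\<close>
  show thesis
  proof (cases "\<exists>c\<in>X. h c > 0 \<and> (a = c \<longrightarrow> ?l m a \<ge> 2)")
    case True
    then obtain c where c: "c \<in> X" "h c > 0" "a = c \<longrightarrow> ?l m a \<ge> 2"
      by blast
    have c_leaf: "c \<in> leaf_numbers"
      using c m by (auto simp: X_def last_leaves_def)
    have "\<theta> \<in> set (leaf_path T c)"
      using c(2) by (simp add: h_def flip: count_greater_zero_iff set_mset_mset)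
    from leaf_path_label_vertex[OF leaf_path_in[OF c_leaf] this] obtain v k q where
      v: "is_vertex v T" "k < length (out_labels T v)" "out_labels T v ! k = \<theta>"
      and q: "q \<in> set (leaf_paths (subtree T (v @ [k])))"
      and c_path: "leaf_path T c = edge_labels T v @ \<theta> # q"
      by metis
    have sim: "(u, v) \<in> sim" and k: "k = j"
      using common_label[OF u(1) v(1) u(3) v(2)] v(3) by (simp_all add: \<theta>_def)
    have same: "out_labels T v = out_labels T u"
      using stage_out_labels[OF sim] by simp
    obtain p' q' where p': "p' \<in> set (leaf_paths (subtree T (u @ [j])))"
      and q': "q' \<in> set (leaf_paths (subtree T (v @ [i])))" and pq: "mset p + mset q = mset p' + mset q'"
      using exchange_between_paths[OF sim i u(3) p, of q] q k by metis
    obtain s where s: "s \<in> leaf_numbers" "a < s" "leaf_path T s = edge_labels T u @ \<theta> # p'"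
      using later_leaf[OF a_leaf u a_path p p'] unfolding \<theta>_def by metis
    have "edge_labels T v @ out_labels T v ! i # q' \<in> set (leaf_paths T)"
      using v(1) i q' by (intro leaf_path_through) (auto simp: same)
    then obtain t where t: "t \<in> leaf_numbers" "leaf_path T t = edge_labels T v @ out_labels T u ! i # q'"
      using same by (metis leaf_number_exists)
    \<comment> \<open>Replacing a leaf by the last one with the same labels only increases its index.\<close>
    obtain a' where a': "a' \<in> last_leaves" "s \<le> a'" "leaf_mono a' = leaf_mono s"
      using last_leaf_exists[OF s(1)] by metis
    obtain c' where c': "c' \<in> last_leaves" "leaf_mono c' = leaf_mono t"
      using last_leaf_exists[OF t(1)] by metis
    have "leaf_mono a + leaf_mono c = leaf_mono a' + leaf_mono c'"
      using pq by (simp add: a'(3) c'(2) a_path c_path s(3) t(2))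
    then show thesis
      using that[of a c a' c'] a c a' c' s(2) a_max by (auto simp: X_def)
  next
    case False
    \<comment> \<open>All occurrences of \<open>\<theta>\<close> below index \<open>b\<close> lie on the path to \<open>a\<close>, which is a simple factor.\<close>
    have "h r = 0" if "r \<in> X" "r \<noteq> a" for r
      using False that by auto
    then have "(\<Sum>r\<in>X. ?l m r * h r) = ?l m a * h a"
      using X a by (subst sum.remove[of X a]) auto
    then have "h a > 0 \<and> ?l m a * h a \<ge> h b"
      using needed h_b by (auto intro: ccontr)
    moreover from this have "?l m a < 2"
      using False a by force
    ultimately have "h b \<le> h a"
      by (metis One_nat_def Suc_1 less_2_cases_iff mult_0 mult_1 le_zero_eq le0)
    have "\<theta> \<in> set p"
    proof (rule ccontr)
      assume "\<theta> \<notin> set p"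
      then have "count (mset p) \<theta> = 0"
        by simp
      with \<open>h b \<le> h a\<close> h_b \<theta>_i show False
        by (simp add: h_def a_path)
    qed
    then obtain q where q: "q \<in> set (leaf_paths (subtree T (u @ [j])))"
      and "add_mset (out_labels T u ! i) (mset p) = add_mset (out_labels T u ! j) (mset q)"
      using exchange_within_path[OF u(1) i u(3) p] unfolding \<theta>_def by metis
    moreover obtain s where "s \<in> leaf_numbers" "a < s" "leaf_path T s = edge_labels T u @ out_labels T u ! j # q"
      using later_leaf[OF a_leaf u a_path p q] by metis
    ultimately have "\<exists>s\<in>leaf_numbers. s > a \<and> leaf_mono a = leaf_mono s"
      using a_path by (intro bexI[of _ s]) simp_all
    then show thesis
      using a_last unfolding last_leaves_def by blast
  qed
qed

end

section \<open>Leading monomials and Groebner bases\<close>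

lemma in_poly_ring_iff:
  "f \<in> carrier (poly_ring X) \<longleftrightarrow> (\<forall>m\<in>Poly_Mapping.keys f. Poly_Mapping.keys m \<subseteq> X)"
  by (simp add: poly_ring_def)

lemma poly_ring_simps [simp]:
  "f \<otimes>\<^bsub>poly_ring X\<^esub> g = f * g" "f \<oplus>\<^bsub>poly_ring X\<^esub> g = f + g"
  "\<one>\<^bsub>poly_ring X\<^esub> = 1" "\<zero>\<^bsub>poly_ring X\<^esub> = 0"
  by (simp_all add: poly_ring_def)

lemma poly_ring_mono: "X \<subseteq> Y \<Longrightarrow> carrier (poly_ring X) \<subseteq> carrier (poly_ring Y)"
  unfolding in_poly_ring_iff subset_iff by blast

lemma monom_in_poly_ring_iff: "monom m \<in> carrier (poly_ring X) \<longleftrightarrow> Poly_Mapping.keys m \<subseteq> X"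
  by (simp add: in_poly_ring_iff monom_def)

lemma var_in_poly_ring_iff: "var x \<in> carrier (poly_ring X) \<longleftrightarrow> x \<in> X"
  by (simp add: var_def monom_in_poly_ring_iff)

lemma add_in_poly_ring:
  "f \<in> carrier (poly_ring X) \<Longrightarrow> g \<in> carrier (poly_ring X) \<Longrightarrow> f + g \<in> carrier (poly_ring X)"
  using Poly_Mapping.keys_add[of f g] by (fastforce simp: in_poly_ring_iff)

lemma diff_in_poly_ring:
  "f \<in> carrier (poly_ring X) \<Longrightarrow> g \<in> carrier (poly_ring X) \<Longrightarrow> f - g \<in> carrier (poly_ring X)"
  using keys_diff[of f g] by (fastforce simp: in_poly_ring_iff)

lemma sum_list_in_poly_ring:
  "(\<And>a. a \<in> set as \<Longrightarrow> f a \<in> carrier (poly_ring X)) \<Longrightarrow> (\<Sum>a\<leftarrow>as. f a) \<in> carrier (poly_ring X)"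
  by (induction as) (auto intro: add_in_poly_ring simp: in_poly_ring_iff[of 0])

lemma keys_monom_diff: "a \<noteq> b \<Longrightarrow> Poly_Mapping.keys (monom a - monom b) = {a, b}"
  by (auto simp: in_keys_iff lookup_minus lookup_single monom_def when_def split: if_splits)

lemma drl_gt_irrefl: "\<not> drl_gt a a"
  by (simp add: drl_gt_def)

lemma drl_gt_trans:
  assumes "drl_gt a b" "drl_gt b c"
  shows "drl_gt a c"
proof (cases "mon_degree a = mon_degree b \<and> mon_degree b = mon_degree c")
  case True
  let ?l = "Poly_Mapping.lookup"
  obtain i j where i: "?l a i < ?l b i" "\<forall>k>i. ?l a k = ?l b k"
    and j: "?l b j < ?l c j" "\<forall>k>j. ?l b k = ?l c k"
    using assms True by (auto simp: drl_gt_def)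
  have "?l a (max i j) < ?l c (max i j) \<and> (\<forall>k>max i j. ?l a k = ?l c k)"
    using i j by (cases i j rule: linorder_cases) (auto simp: max_def)
  then show ?thesis
    using True unfolding drl_gt_def by metis
next
  case False
  then show ?thesis
    using assms by (auto simp: drl_gt_def)
qed

lemma drl_gt_total:
  assumes "a \<noteq> b"
  shows "drl_gt a b \<or> drl_gt b a"
proof (cases "mon_degree a = mon_degree b")
  case True
  let ?D = "{i. Poly_Mapping.lookup a i \<noteq> Poly_Mapping.lookup b i}"
  have fin: "finite ?D"
    by (rule finite_subset[of _ "Poly_Mapping.keys a \<union> Poly_Mapping.keys b"]) (auto simp: in_keys_iff)
  have "?D \<noteq> {}"
    using assms by (auto intro: poly_mapping_eqI)
  with fin have "Max ?D \<in> ?D"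
    by (rule Max_in)
  moreover have "Poly_Mapping.lookup a j = Poly_Mapping.lookup b j" if "j > Max ?D" for j
    using Max_ge[OF fin, of j] that by auto
  ultimately show ?thesis
    using True unfolding drl_gt_def by (metis (mono_tags) linorder_neqE_nat mem_Collect_eq)
next
  case False
  then show ?thesis
    by (auto simp: drl_gt_def)
qed

lemma lead_mon_eqI:
  assumes "m \<in> Poly_Mapping.keys f" "\<And>k. k \<in> Poly_Mapping.keys f \<Longrightarrow> k \<noteq> m \<Longrightarrow> drl_gt m k"
  shows "lead_mon drl_gt f = m"
  unfolding lead_mon_def
proof (rule the_equality)
  fix k assume k: "k \<in> Poly_Mapping.keys f \<and> (\<forall>m'\<in>Poly_Mapping.keys f. m' \<noteq> k \<longrightarrow> drl_gt k m')"
  show "k = m"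
  proof (rule ccontr)
    assume "k \<noteq> m"
    then have "drl_gt k m" "drl_gt m k"
      using k assms by auto
    then show False
      using drl_gt_trans drl_gt_irrefl by blast
  qed
qed (use assms in auto)

lemma lead_mon_props:
  assumes "f \<noteq> 0"
  shows "lead_mon drl_gt f \<in> Poly_Mapping.keys f"
    and "\<And>k. k \<in> Poly_Mapping.keys f \<Longrightarrow> k \<noteq> lead_mon drl_gt f \<Longrightarrow> drl_gt (lead_mon drl_gt f) k"
proof -
  have max: "finite A \<Longrightarrow> A \<noteq> {} \<Longrightarrow> \<exists>m\<in>A. \<forall>k\<in>A. k \<noteq> m \<longrightarrow> drl_gt m k" for A
  proof (induction A rule: finite_ne_induct)
    case (insert a A)
    then obtain m where m: "m \<in> A" "\<And>k. k \<in> A \<Longrightarrow> k \<noteq> m \<Longrightarrow> drl_gt m k"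
      by blast
    show ?case
    proof (cases "drl_gt a m")
      case True
      then have "drl_gt a k" if "k \<in> A" for k
        using m(2)[OF that] drl_gt_trans by (cases "k = m") blast+
      then show ?thesis
        by blast
    next
      case False
      then have "drl_gt m a"
        using drl_gt_total[of a m] m insert.hyps by auto
      then show ?thesis
        using m by (intro bexI[of _ m]) auto
    qed
  qed simp
  have "Poly_Mapping.keys f \<noteq> {}"
    using assms by simp
  from max[OF finite_keys this] obtain m where m: "m \<in> Poly_Mapping.keys f"
    "\<And>k. k \<in> Poly_Mapping.keys f \<Longrightarrow> k \<noteq> m \<Longrightarrow> drl_gt m k"
    by blast
  then have "lead_mon drl_gt f = m"
    by (rule lead_mon_eqI)
  with m show "lead_mon drl_gt f \<in> Poly_Mapping.keys f"
    and "\<And>k. k \<in> Poly_Mapping.keys f \<Longrightarrow> k \<noteq> lead_mon drl_gt f \<Longrightarrow> drl_gt (lead_mon drl_gt f) k"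
    by auto
qed

lemma monom_add: "monom (a + b) = monom a * monom b"
  by (simp add: monom_def mult_single)

lemma groebner_basisI:
  assumes "finite G" "G \<subseteq> I" and I: "I \<subseteq> carrier (poly_ring X)"
    and divides: "\<And>f. f \<in> I \<Longrightarrow> f \<noteq> 0 \<Longrightarrow>
      \<exists>g\<in>G. g \<noteq> 0 \<and> (\<exists>k. lead_mon drl_gt f = k + lead_mon drl_gt g)"
  shows "groebner_basis drl_gt X G I"
proof -
  interpret cring "poly_ring X"
    by (rule cring_poly_ring)
  let ?L = "\<lambda>S. {monom (lead_mon drl_gt f) | f. f \<in> S \<and> f \<noteq> 0}"
  have L: "?L S \<subseteq> carrier (poly_ring X)" if "S \<subseteq> I" for S
  proof -
    have "Poly_Mapping.keys (lead_mon drl_gt f) \<subseteq> X" if "f \<in> S" "f \<noteq> 0" for f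
    proof -
      have "f \<in> carrier (poly_ring X)"
        using \<open>f \<in> S\<close> \<open>S \<subseteq> I\<close> I by blast
      then show ?thesis
        using lead_mon_props(1)[OF \<open>f \<noteq> 0\<close>] unfolding in_poly_ring_iff by blast
    qed
    then show ?thesis
      by (auto simp: monom_in_poly_ring_iff)
  qed
  have ideal: "ideal (Idl\<^bsub>poly_ring X\<^esub> ?L G) (poly_ring X)"
    using L[OF assms(2)] by (rule genideal_ideal)
  have "?L I \<subseteq> Idl\<^bsub>poly_ring X\<^esub> ?L G"
  proof clarify
    fix f assume f: "f \<in> I" "f \<noteq> 0"
    then obtain g k where g: "g \<in> G" "g \<noteq> 0" "lead_mon drl_gt f = k + lead_mon drl_gt g"
      using divides by metis
    have "monom (lead_mon drl_gt f) \<in> carrier (poly_ring X)"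
      using L[of I] f by blast
    then have "Poly_Mapping.keys (lead_mon drl_gt f) \<subseteq> X"
      by (simp only: monom_in_poly_ring_iff)
    moreover have "Poly_Mapping.keys k \<subseteq> Poly_Mapping.keys (lead_mon drl_gt f)"
      by (auto simp: g(3) in_keys_iff lookup_add)
    ultimately have "monom k \<in> carrier (poly_ring X)"
      by (simp add: monom_in_poly_ring_iff)
    moreover have "monom (lead_mon drl_gt g) \<in> Idl\<^bsub>poly_ring X\<^esub> ?L G"
      using genideal_self[OF L[OF assms(2)]] g by blast
    ultimately show "monom (lead_mon drl_gt f) \<in> Idl\<^bsub>poly_ring X\<^esub> ?L G"
      using ideal.I_l_closed[OF ideal] by (auto simp: g(3) monom_add)
  qed
  then have "Idl\<^bsub>poly_ring X\<^esub> ?L I \<subseteq> Idl\<^bsub>poly_ring X\<^esub> ?L G"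
    by (rule genideal_minimal[OF ideal])
  moreover have "Idl\<^bsub>poly_ring X\<^esub> ?L G \<subseteq> Idl\<^bsub>poly_ring X\<^esub> ?L I"
  proof (rule genideal_minimal)
    show "ideal (Idl\<^bsub>poly_ring X\<^esub> ?L I) (poly_ring X)"
      using L by (intro genideal_ideal) auto
    show "?L G \<subseteq> Idl\<^bsub>poly_ring X\<^esub> ?L I"
      using genideal_self[OF L[OF order_refl]] assms(2) by blast
  qed
  ultimately show ?thesis
    using assms(1,2) by (simp add: groebner_basis_def initial_ideal_def)
qed

lemma lookup_le_mon_degree: "Poly_Mapping.lookup m x \<le> mon_degree m"
proof (cases "x \<in> Poly_Mapping.keys m")
  case True
  then show ?thesis
    unfolding mon_degree_def by (intro member_le_sum) auto
next
  case False
  then show ?thesis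
    by (simp add: in_keys_iff)
qed

lemma finite_bounded_monomials:
  assumes "finite X"
  shows "finite {m. Poly_Mapping.keys m \<subseteq> X \<and> mon_degree m \<le> d}" (is "finite ?B")
proof (rule finite_imageD)
  show "inj_on Poly_Mapping.lookup ?B"
    by (auto intro!: inj_onI poly_mapping_eqI)
  have "Poly_Mapping.lookup ` ?B \<subseteq>
      {f. \<forall>x. (x \<in> X \<longrightarrow> f x \<in> {..d}) \<and> (x \<notin> X \<longrightarrow> f x = 0)}"
  proof clarify
    fix m x assume m: "Poly_Mapping.keys m \<subseteq> X" "mon_degree m \<le> d"
    then have "Poly_Mapping.lookup m x \<le> d"
      using lookup_le_mon_degree[of m x] by simp
    moreover have "x \<notin> X \<Longrightarrow> Poly_Mapping.lookup m x = 0"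
      using m(1) by (meson in_keys_iff subsetD)
    ultimately show "(x \<in> X \<longrightarrow> Poly_Mapping.lookup m x \<in> {..d}) \<and>
        (x \<notin> X \<longrightarrow> Poly_Mapping.lookup m x = 0)"
      by simp
  qed
  then show "finite (Poly_Mapping.lookup ` ?B)"
    by (rule finite_subset) (use assms in \<open>intro finite_set_of_finite_funs, auto\<close>)
qed

lemma finite_bounded_binomials:
  assumes "finite X"
  shows "finite {f \<in> carrier (poly_ring X). is_binomial f \<and> total_degree f = d}"
proof (rule finite_subset)
  let ?B = "{m. Poly_Mapping.keys m \<subseteq> X \<and> mon_degree m \<le> d}"
  show "finite ((\<lambda>(a, b). monom a - monom b) ` (?B \<times> ?B))"
    using finite_bounded_monomials[OF assms] by blast
  show "{f \<in> carrier (poly_ring X). is_binomial f \<and> total_degree f = d} \<subseteq>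
      (\<lambda>(a, b). monom a - monom b) ` (?B \<times> ?B)"
  proof clarify
    fix f assume f: "f \<in> carrier (poly_ring X)" "is_binomial f" and d: "d = total_degree f"
    obtain a b where ab: "a \<noteq> b" "f = monom a - monom b"
      using f(2) by (auto simp: is_binomial_def)
    have "a \<in> {m. Poly_Mapping.keys m \<subseteq> X \<and> mon_degree m \<le> total_degree f}"
      "b \<in> {m. Poly_Mapping.keys m \<subseteq> X \<and> mon_degree m \<le> total_degree f}"
      using f(1) ab by (auto simp: in_poly_ring_iff keys_monom_diff total_degree_def)
    then show "f \<in> (\<lambda>(a, b). monom a - monom b) `
        ({m. Poly_Mapping.keys m \<subseteq> X \<and> mon_degree m \<le> total_degree f} \<times>
         {m. Poly_Mapping.keys m \<subseteq> X \<and> mon_degree m \<le> total_degree f})"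
      using ab by auto
  qed
qed

section \<open>The kernel is toric\<close>

lemma vanishing_ideal:
  "ideal {f \<in> carrier (poly_ring X). eval_poly y f = 0} (poly_ring X)"
    (is "ideal ?J ?R")
proof (rule idealI)
  interpret cring ?R
    by (rule cring_poly_ring)
  show "ring ?R"
    by (rule ring_axioms)
  show "subgroup ?J (add_monoid ?R)"
  proof (rule group.subgroupI)
    show "group (add_monoid ?R)"
      by (rule a_group)
    show "?J \<subseteq> carrier (add_monoid ?R)" and "?J \<noteq> {}"
      by (auto simp: in_poly_ring_iff intro!: exI[of _ 0])
    show "a \<otimes>\<^bsub>add_monoid ?R\<^esub> b \<in> ?J" if "a \<in> ?J" "b \<in> ?J" for a b
      using that by (auto simp: eval_poly_add add_in_poly_ring)
    show "inv\<^bsub>add_monoid ?R\<^esub> a \<in> ?J" if a: "a \<in> ?J" for a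
    proof -
      have "\<ominus>\<^bsub>?R\<^esub> a \<in> carrier ?R" "a + \<ominus>\<^bsub>?R\<^esub> a = 0"
        using a a_inv_closed[of a] r_neg[of a] by auto
      moreover from this have "eval_poly y (\<ominus>\<^bsub>?R\<^esub> a) = 0"
        using a eval_poly_add[of y a "\<ominus>\<^bsub>?R\<^esub> a"] by simp
      ultimately show ?thesis
        by (simp add: a_inv_def)
    qed
  qed
  show "x \<otimes>\<^bsub>?R\<^esub> a \<in> ?J" and "a \<otimes>\<^bsub>?R\<^esub> x \<in> ?J" if "a \<in> ?J" "x \<in> carrier ?R" for a x
    using that m_closed[of a x] m_closed[of x a] by (auto simp: eval_poly_mult)
qed

definition sums_to_z :: "'l plane_tree \<Rightarrow> ('l param \<Rightarrow> real) \<Rightarrow> bool" where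
  "sums_to_z T y \<longleftrightarrow> (\<forall>v\<in>inner_vertices T. (\<Sum>\<theta>\<leftarrow>out_labels T v. y (Lab \<theta>)) = y Z)"

text \<open>The polynomials that vanish at a point of the variety form an ideal containing the generators.\<close>

lemma sum_ideal_vanishes:
  assumes "f \<in> sum_ideal T" "sums_to_z T y"
  shows "eval_poly y f = 0"
proof -
  let ?J = "{f \<in> carrier (param_ring T). eval_poly y f = 0}"
  interpret cring "param_ring T"
    unfolding param_ring_def by (rule cring_poly_ring)
  have "sum_ideal T \<subseteq> ?J"
    unfolding sum_ideal_def
  proof (rule genideal_minimal)
    show "ideal ?J (param_ring T)"
      unfolding param_ring_def by (rule vanishing_ideal)
    have "(\<Sum>\<theta>\<leftarrow>out_labels T v. var (Lab \<theta>)) - var Z \<in> carrier (param_ring T)"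
      if "v \<in> inner_vertices T" for v
      unfolding param_ring_def using that
      by (intro diff_in_poly_ring sum_list_in_poly_ring)
        (auto simp: var_in_poly_ring_iff labels_def inner_vertices_def)
    moreover have "eval_poly y ((\<Sum>\<theta>\<leftarrow>out_labels T v. var (Lab \<theta>)) - var Z) = 0"
      if "v \<in> inner_vertices T" for v
      using assms(2) that by (simp add: eval_poly_diff eval_poly_sum_list sums_to_z_def)
    ultimately show "{(\<Sum>\<theta>\<leftarrow>out_labels T v. var (Lab \<theta>)) - var Z | v. v \<in> inner_vertices T} \<subseteq> ?J"
      by blast
  qed
  with assms show ?thesis
    by blast
qed

lemma zero_in_sum_ideal: "0 \<in> sum_ideal T"
proof -
  have "0 \<in> I" if "ideal I (param_ring T)" for I
    using additive_subgroup.zero_closed[OF ideal.axioms(1)[OF that]]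
    by (simp add: param_ring_def)
  then show ?thesis
    by (auto simp: sum_ideal_def genideal_def)
qed

lemma phi_coset:
  assumes "f \<in> carrier (poly_ring {1..num_leaves T})"
  shows "phi T f = (\<lambda>h. h + subst (leaf_monomial T) f) ` sum_ideal T"
  using assms by (auto simp: phi_def a_r_coset_def' param_ring_def)

lemma phi_eq_vals:
  assumes "f \<in> carrier (poly_ring {1..num_leaves T})" "g \<in> carrier (poly_ring {1..num_leaves T})"
    and "phi T f = phi T g" "sums_to_z T y"
  shows "eval_poly y (subst (leaf_monomial T) f) = eval_poly y (subst (leaf_monomial T) g)"
proof -
  have "subst (leaf_monomial T) f \<in> phi T f"
    using zero_in_sum_ideal[of T] unfolding phi_coset[OF assms(1)] by force
  then obtain h where "h \<in> sum_ideal T" "subst (leaf_monomial T) f = h + subst (leaf_monomial T) g"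
    unfolding assms(3) phi_coset[OF assms(2)] by blast
  then show ?thesis
    using sum_ideal_vanishes[OF _ assms(4)] by (simp add: eval_poly_add)
qed

lemma subst_0 [simp]: "subst g 0 = 0"
  by (simp add: subst_def)

lemma const_1 [simp]: "const 1 = 1" and const_minus_1 [simp]: "const (- 1) = - 1"
  by (simp_all add: const_def single_uminus)

lemma subst_var: "subst g (var x) = g x"
  by (simp add: subst_def var_def monom_def)

lemma subst_monom_diff:
  fixes a b :: "'a \<Rightarrow>\<^sub>0 nat"
  assumes "a \<noteq> b"
  shows "subst g (monom a - monom b) = mon_val g a - mon_val g b"
proof -
  have "Poly_Mapping.lookup (monom a - monom b :: 'a mpoly) a = 1"
    "Poly_Mapping.lookup (monom a - monom b :: 'a mpoly) b = - 1"
    using assms by (auto simp: lookup_minus monom_def lookup_single when_def)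
  then show ?thesis
    using assms by (simp add: subst_def keys_monom_diff mon_val_def)
qed

lemma ker_phi_bar_iff:
  "f \<in> ker_phi_bar T \<longleftrightarrow> f \<in> carrier (poly_ring (kept_indices T)) \<and> phi T f = phi T 0"
proof -
  have "phi T 0 = sum_ideal T"
    by (subst phi_coset) (simp_all add: in_poly_ring_iff)
  then show ?thesis
    by (auto simp: ker_phi_bar_def a_kernel_def' phi_bar_def quot_ring_def FactRing_def)
qed

context balanced_tree
begin

lemma nat_poly_val_inner:
  assumes "out_labels T u \<noteq> []"
  shows "nat_poly_val x (monos_at u) =
    (\<Sum>i<length (out_labels T u). x (out_labels T u ! i) * nat_poly_val x (monos_at (u @ [i])))"
  by (simp add: path_monos_inner[OF assms] nat_poly_val_sum nat_poly_val_image_add_mset)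

text \<open>The conditional probability of an edge when leaves are weighted by the products of \<open>x\<close> along their
  paths. It is defined on labels through any edge that carries the label; \<open>edge_ratio_stage\<close> shows that
  the choice does not matter.\<close>

definition edge_prob :: "('l \<Rightarrow> real) \<Rightarrow> 'l \<Rightarrow> real" where
  "edge_prob x \<theta> = (SOME c. \<exists>u i. is_vertex u T \<and> i < length (out_labels T u) \<and> out_labels T u ! i = \<theta> \<and>
     c = x \<theta> * nat_poly_val x (monos_at (u @ [i])) / nat_poly_val x (monos_at u))"

context
  fixes x :: "'l \<Rightarrow> real"
  assumes x_pos: "\<And>\<theta>. x \<theta> > 0"
begin

lemma nat_poly_val_at_pos: "nat_poly_val x (monos_at u) > 0"
  using x_pos path_monos_nonempty by (rule nat_poly_val_pos)

text \<open>Summing \<open>t(u\<^sub>i) t(v\<^sub>l) = t(u\<^sub>l) t(v\<^sub>i)\<close> over \<open>l\<close> with weights \<open>x\<^sub>l\<close> gives \<open>t(u\<^sub>i) t(v) = t(u) t(v\<^sub>i)\<close>.\<close>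

lemma edge_ratio_stage:
  assumes "(u, v) \<in> sim" "i < length (out_labels T u)"
  shows "nat_poly_val x (monos_at (u @ [i])) / nat_poly_val x (monos_at u) =
         nat_poly_val x (monos_at (v @ [i])) / nat_poly_val x (monos_at v)"
proof -
  have same: "out_labels T v = out_labels T u"
    using stage_out_labels[OF assms(1)] by simp
  have ne: "out_labels T u \<noteq> []"
    using assms by auto
  have "nat_poly_val x (monos_at (u @ [i])) * nat_poly_val x (monos_at v) =
      (\<Sum>l<length (out_labels T u). x (out_labels T u ! l) *
         (nat_poly_val x (monos_at (u @ [i])) * nat_poly_val x (monos_at (v @ [l]))))"
    using ne same by (simp add: nat_poly_val_inner sum_distrib_left algebra_simps)
  also have "\<dots> = (\<Sum>l<length (out_labels T u). x (out_labels T u ! l) *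
         (nat_poly_val x (monos_at (u @ [l])) * nat_poly_val x (monos_at (v @ [i]))))"
    using balanced_nat_poly_val[OF assms] by simp
  also have "\<dots> = nat_poly_val x (monos_at u) * nat_poly_val x (monos_at (v @ [i]))"
    by (simp only: nat_poly_val_inner[OF ne] sum_distrib_right mult.assoc)
  finally show ?thesis
    using nat_poly_val_at_pos[of u] nat_poly_val_at_pos[of v] by (simp add: field_simps)
qed

lemma edge_prob_at:
  assumes "is_vertex v T" "i < length (out_labels T v)"
  shows "edge_prob x (out_labels T v ! i) =
    x (out_labels T v ! i) * nat_poly_val x (monos_at (v @ [i])) / nat_poly_val x (monos_at v)"
  unfolding edge_prob_def
proof (rule some_equality)
  show "\<exists>u j. is_vertex u T \<and> j < length (out_labels T u) \<and> out_labels T u ! j = out_labels T v ! i \<and>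
      x (out_labels T v ! i) * nat_poly_val x (monos_at (v @ [i])) / nat_poly_val x (monos_at v) =
      x (out_labels T v ! i) * nat_poly_val x (monos_at (u @ [j])) / nat_poly_val x (monos_at u)"
    using assms by blast
next
  fix c
  assume "\<exists>u j. is_vertex u T \<and> j < length (out_labels T u) \<and> out_labels T u ! j = out_labels T v ! i \<and>
      c = x (out_labels T v ! i) * nat_poly_val x (monos_at (u @ [j])) / nat_poly_val x (monos_at u)"
  then obtain u j where u: "is_vertex u T" "j < length (out_labels T u)" "out_labels T u ! j = out_labels T v ! i"
    and c: "c = x (out_labels T v ! i) * nat_poly_val x (monos_at (u @ [j])) / nat_poly_val x (monos_at u)"
    by blast
  have "(u, v) \<in> sim" "j = i"
    using common_label[OF u(1) assms(1) u(2) assms(2) u(3)] by auto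
  then show "c = x (out_labels T v ! i) * nat_poly_val x (monos_at (v @ [i])) / nat_poly_val x (monos_at v)"
    using edge_ratio_stage[of u v i] u(2) c by (metis times_divide_eq_right)
qed

lemma edge_prob_sum:
  assumes "v \<in> inner_vertices T"
  shows "(\<Sum>\<theta>\<leftarrow>out_labels T v. edge_prob x \<theta>) = 1"
proof -
  have v: "is_vertex v T" "out_labels T v \<noteq> []"
    using assms by (auto simp: inner_vertices_def vertices_def)
  have "(\<Sum>\<theta>\<leftarrow>out_labels T v. edge_prob x \<theta>) =
      (\<Sum>i<length (out_labels T v). edge_prob x (out_labels T v ! i))"
    by (simp add: sum_list_sum_nth atLeast0LessThan)
  also have "\<dots> = (\<Sum>i<length (out_labels T v).
      x (out_labels T v ! i) * nat_poly_val x (monos_at (v @ [i])) / nat_poly_val x (monos_at v))"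
    by (simp add: edge_prob_at[OF v(1)])
  also have "\<dots> = nat_poly_val x (monos_at v) / nat_poly_val x (monos_at v)"
    by (simp only: sum_divide_distrib[symmetric] nat_poly_val_inner[OF v(2), symmetric])
  finally show ?thesis
    using nat_poly_val_at_pos[of v] by simp
qed

text \<open>The ratios \<open>t(v\<^sub>i)/t(v)\<close> telescope along the path, down to the value \<open>1\<close> at the leaf.\<close>

lemma edge_prob_path:
  assumes "is_vertex v T" "p \<in> set (leaf_paths (subtree T v))"
  shows "(\<Prod>\<theta>\<leftarrow>p. edge_prob x \<theta>) * nat_poly_val x (monos_at v) = label_val x (mset p)"
  using assms
proof (induction p arbitrary: v)
  case Nil
  then have "out_labels T v = []"
    by (auto simp: leaf_paths_iff[of _ "subtree T v"] out_labels_def)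
  then show ?case
    by (simp add: path_monos_leaf)
next
  case (Cons \<theta> p)
  obtain i where i: "i < length (out_labels T v)" "\<theta> = out_labels T v ! i"
    "p \<in> set (leaf_paths (subtree T (v @ [i])))"
    using Cons.prems(2) by (auto simp: leaf_paths_iff[of _ "subtree T v"] out_labels_def subtree_append)
  have rest: "(\<Prod>\<theta>\<leftarrow>p. edge_prob x \<theta>) * nat_poly_val x (monos_at (v @ [i])) = label_val x (mset p)"
    using Cons.IH[of "v @ [i]"] Cons.prems(1) i by (simp add: is_vertex_child)
  have first: "edge_prob x \<theta> * nat_poly_val x (monos_at v) = x \<theta> * nat_poly_val x (monos_at (v @ [i]))"
    using edge_prob_at[OF Cons.prems(1) i(1)] nat_poly_val_at_pos[of v] i(2) by simp
  have "(\<Prod>\<eta>\<leftarrow>\<theta> # p. edge_prob x \<eta>) * nat_poly_val x (monos_at v) =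
      (edge_prob x \<theta> * nat_poly_val x (monos_at v)) * (\<Prod>\<eta>\<leftarrow>p. edge_prob x \<eta>)"
    by simp
  also have "\<dots> = x \<theta> * ((\<Prod>\<eta>\<leftarrow>p. edge_prob x \<eta>) * nat_poly_val x (monos_at (v @ [i])))"
    unfolding first by simp
  finally show ?case
    unfolding rest by simp
qed

end

lemma leaf_path_length_le: "r \<in> leaf_numbers \<Longrightarrow> length (leaf_path T r) \<le> max_depth T"
  unfolding max_depth_def by (intro Max_ge) auto

lemma max_depth_pos:
  assumes "branches T \<noteq> []"
  shows "max_depth T > 0"
proof -
  obtain p where "p \<in> set (leaf_paths T)"
    using leaf_paths_nonempty[of T] by (meson last_in_set)
  then obtain r where r: "r \<in> leaf_numbers" "leaf_path T r = p"
    using leaf_number_exists by metis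
  have "p \<noteq> []"
    using assms \<open>p \<in> set (leaf_paths T)\<close> by (auto simp: leaf_paths_iff[of _ T])
  then have "0 < length (leaf_path T r)"
    using r(2) by simp
  also have "\<dots> \<le> max_depth T"
    using r(1) by (rule leaf_path_length_le)
  finally show ?thesis .
qed

text \<open>With \<open>w\<^sup>d = s t(root)\<close>, where \<open>d\<close> is the maximal depth, the parameters \<open>z = w\<close> and
  \<open>\<theta> = w \<cdot> edge_prob x \<theta>\<close> do it: a path of length \<open>l\<close> contributes \<open>w\<^sup>l\<close>, which the factor
  \<open>z\<^sup>d\<^sup>-\<^sup>l\<close> completes to \<open>w\<^sup>d\<close>.\<close>

lemma parameters_for_monomials:
  fixes s :: real
  assumes inner: "branches T \<noteq> []" and x: "\<And>\<theta>. x \<theta> > 0" and s: "s > 0"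
  shows "\<exists>y. sums_to_z T y \<and>
    (\<forall>r\<in>leaf_numbers. eval_poly y (leaf_monomial T r) = s * label_val x (leaf_mono r))"
proof (intro exI conjI ballI)
  define d where "d = max_depth T"
  define t where "t = nat_poly_val x (monos_at [])"
  define w where "w = root d (s * t)"
  have "d > 0"
    using max_depth_pos[OF inner] by (simp add: d_def)
  then have w: "w ^ d = s * t"
    unfolding w_def using s nat_poly_val_at_pos[where x = x, OF x, where u = "[]"] by (simp add: t_def)
  define y where "y = case_param (\<lambda>\<theta>. w * edge_prob x \<theta>) w"
  show "sums_to_z T y"
    using edge_prob_sum[where x = x, OF x]
    by (simp add: sums_to_z_def y_def sum_list_const_mult)
  fix r assume r: "r \<in> leaf_numbers"
  let ?p = "leaf_path T r"
  have "(\<Prod>\<theta>\<leftarrow>p. w * edge_prob x \<theta>) = w ^ length p * (\<Prod>\<theta>\<leftarrow>p. edge_prob x \<theta>)" for p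
    by (induction p) simp_all
  then have "eval_poly y (leaf_monomial T r) =
      w ^ (d - length ?p) * w ^ length ?p * (\<Prod>\<theta>\<leftarrow>?p. edge_prob x \<theta>)"
    by (simp add: leaf_monomial_def eval_poly_mult eval_poly_power eval_poly_prod_list y_def d_def)
  also have "w ^ (d - length ?p) * w ^ length ?p = s * t"
    using leaf_path_length_le[OF r] w by (simp add: d_def flip: power_add)
  finally show "eval_poly y (leaf_monomial T r) = s * label_val x (leaf_mono r)"
    using edge_prob_path[where x = x, OF x, where v = "[]" and p = ?p] leaf_path_in[OF r] by (simp add: t_def algebra_simps)
qed

text \<open>Equality modulo the sum-to-\<open>z\<close> relations forces equality at all toric points, because these points
  are parametrised by the variety of the relations.\<close>

lemma phi_eq_imp_toric_eq:
  fixes s :: real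
  assumes inner: "branches T \<noteq> []"
    and f: "f \<in> carrier (poly_ring leaf_numbers)" and g: "g \<in> carrier (poly_ring leaf_numbers)"
    and eq: "phi T f = phi T g" and "s > 0" "\<And>\<theta>. x \<theta> > 0"
  shows "eval_poly (\<lambda>r. s * label_val x (leaf_mono r)) f = eval_poly (\<lambda>r. s * label_val x (leaf_mono r)) g"
proof -
  obtain y where y: "sums_to_z T y"
    "\<And>r. r \<in> leaf_numbers \<Longrightarrow> eval_poly y (leaf_monomial T r) = s * label_val x (leaf_mono r)"
    using parameters_for_monomials[where x = x, OF inner \<open>\<And>\<theta>. x \<theta> > 0\<close> \<open>s > 0\<close>] by blast
  have "eval_poly y (subst (leaf_monomial T) h) = eval_poly (\<lambda>r. s * label_val x (leaf_mono r)) h"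
    if "h \<in> carrier (poly_ring leaf_numbers)" for h
    unfolding eval_poly_subst using that by (rule eval_poly_cong) (rule y(2))
  then show ?thesis
    using phi_eq_vals[OF f g eq y(1)] f g by simp
qed

lemma leaf_monomial_cong:
  assumes "leaf_mono r = leaf_mono s"
  shows "leaf_monomial T r = leaf_monomial T s"
proof -
  have "length (leaf_path T r) = length (leaf_path T s)"
    using assms by (metis size_mset)
  moreover have "(\<Prod>\<theta>\<leftarrow>leaf_path T r. f \<theta>) = (\<Prod>\<theta>\<leftarrow>leaf_path T s. f \<theta>)" for f :: "'l \<Rightarrow> 'l param mpoly"
    using assms by (metis mset_map prod_mset_prod_list)
  ultimately show ?thesis
    by (simp add: leaf_monomial_def)
qed

lemma phi_var_eq_iff:
  assumes inner: "branches T \<noteq> []" and r: "r \<in> leaf_numbers" and s: "s \<in> leaf_numbers"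
  shows "phi T (var r) = phi T (var s) \<longleftrightarrow> leaf_mono r = leaf_mono s"
proof
  assume eq: "phi T (var r) = phi T (var s)"
  have "{#leaf_mono r#} = {#leaf_mono s#}"
  proof (rule nat_poly_val_inject)
    fix x :: "'l \<Rightarrow> real" assume "\<And>\<theta>. x \<theta> > 0"
    then show "nat_poly_val x {#leaf_mono r#} = nat_poly_val x {#leaf_mono s#}"
      using phi_eq_imp_toric_eq[OF inner _ _ eq, of 1 x] r s by (simp add: var_in_poly_ring_iff)
  qed
  then show "leaf_mono r = leaf_mono s"
    by simp
next
  assume "leaf_mono r = leaf_mono s"
  then show "phi T (var r) = phi T (var s)"
    using r s by (simp add: phi_coset var_in_poly_ring_iff subst_var leaf_monomial_cong[of r s])
qed

lemma last_leaves_subset: "last_leaves \<subseteq> leaf_numbers"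
  unfolding last_leaves_def by blast

lemma kept_indices_eq: "branches T \<noteq> [] \<Longrightarrow> kept_indices T = last_leaves"
  unfolding kept_indices_def last_leaves_def using phi_var_eq_iff by blast

lemma mon_val_leaves:
  fixes w :: "'b :: comm_monoid_mult"
  shows "mon_val (\<lambda>r. w ^ e r * (\<Prod>\<theta>\<in>#leaf_mono r. y \<theta>)) m =
    w ^ (\<Sum>r\<in>Poly_Mapping.keys m. e r * Poly_Mapping.lookup m r) * (\<Prod>\<theta>\<in>#label_content m. y \<theta>)"
proof -
  have repeat: "(\<Prod>\<theta>\<in>#repeat_mset k N. y \<theta>) = (\<Prod>\<theta>\<in>#N. y \<theta>) ^ k" for k N
    by (induction k) simp_all
  have "(\<Prod>\<theta>\<in>#(\<Sum>r\<in>A. repeat_mset (k r) (leaf_mono r)). y \<theta>) =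
        (\<Prod>r\<in>A. (\<Prod>\<theta>\<in>#leaf_mono r. y \<theta>) ^ k r)" for A k
    by (induction A rule: infinite_finite_induct) (simp_all add: repeat)
  then show ?thesis
    by (simp add: mon_val_def label_content_def power_mult_distrib prod.distrib power_mult power_sum)
qed

text \<open>The toric map sends the monomials of \<open>f\<close> to monomials, so within each class of equal image the
  coefficients of \<open>f\<close> sum to zero, and no class has exactly one member.\<close>

lemma homogeneous_partner:
  assumes inner: "branches T \<noteq> []" and f: "f \<in> carrier (poly_ring leaf_numbers)" "phi T f = phi T 0"
    and m: "m \<in> Poly_Mapping.keys f"
  obtains m' where "m' \<in> Poly_Mapping.keys f" "m' \<noteq> m" "mon_degree m' = mon_degree m"
    and "label_content m' = label_content m"
proof -
  define im where "im k = (mon_degree k, label_content k)" for k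
  define c where "c p = (\<Sum>k\<in>{k \<in> Poly_Mapping.keys f. im k = p}. Poly_Mapping.lookup f k)" for p
  have "c (im m) = 0"
  proof (rule label_monomials_independent[of "im ` Poly_Mapping.keys f"])
    fix s :: real and x :: "'l \<Rightarrow> real" assume sx: "s > 0" "\<And>\<theta>. x \<theta> > 0"
    have "mon_val (\<lambda>r. s * label_val x (leaf_mono r)) k = s ^ mon_degree k * label_val x (label_content k)" for k
      using mon_val_leaves[of s "\<lambda>_. 1" x k] by (simp add: label_val_def mon_degree_def)
    then have "0 = (\<Sum>k\<in>Poly_Mapping.keys f. Poly_Mapping.lookup f k *
        (s ^ mon_degree k * label_val x (label_content k)))"
      using phi_eq_imp_toric_eq[where x = x, OF inner f(1) _ f(2) sx] by (simp add: eval_poly_def in_poly_ring_iff)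
    also have "\<dots> = (\<Sum>p\<in>im ` Poly_Mapping.keys f. \<Sum>k\<in>{k \<in> Poly_Mapping.keys f. im k = p}.
        Poly_Mapping.lookup f k * (s ^ mon_degree k * label_val x (label_content k)))"
      by (rule sum.image_gen) simp
    also have "\<dots> = (\<Sum>(d, N)\<in>im ` Poly_Mapping.keys f. c (d, N) * (s ^ d * label_val x N))"
      by (intro sum.cong) (auto simp: c_def im_def sum_distrib_right)
    finally show "(\<Sum>(d, N)\<in>im ` Poly_Mapping.keys f. c (d, N) * (s ^ d * label_val x N)) = 0"
      by simp
  qed (use m in auto)
  then have "{k \<in> Poly_Mapping.keys f. im k = im m} \<noteq> {m}"
    using m by (auto simp: c_def in_keys_iff)
  then obtain m' where "m' \<in> Poly_Mapping.keys f" "im m' = im m" "m' \<noteq> m"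
    using m by blast
  then show thesis
    using that by (simp add: im_def)
qed

text \<open>Degree and label content determine the exponent of \<open>z\<close> as well: each variable contributes \<open>d\<close>
  factors in total, so the two monomials have literally the same image.\<close>

lemma binomial_in_kernel:
  assumes inner: "branches T \<noteq> []" and "a \<noteq> b"
    and keys: "Poly_Mapping.keys a \<subseteq> last_leaves" "Poly_Mapping.keys b \<subseteq> last_leaves"
    and deg: "mon_degree a = mon_degree b" and content: "label_content a = label_content b"
  shows "monom a - monom b \<in> ker_phi_bar T"
proof -
  let ?e = "\<lambda>r. max_depth T - length (leaf_path T r)"
  let ?E = "\<lambda>m. \<Sum>r\<in>Poly_Mapping.keys m. ?e r * Poly_Mapping.lookup m r"
  have leaf: "leaf_monomial T = (\<lambda>r. var Z ^ ?e r * (\<Prod>\<theta>\<in>#leaf_mono r. var (Lab \<theta>)))"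
    by (rule ext) (simp add: leaf_monomial_def flip: prod_mset_prod_list)
  have E: "?E m + size (label_content m) = max_depth T * mon_degree m" if "Poly_Mapping.keys m \<subseteq> last_leaves" for m
  proof -
    have "size (label_content m) =
        (\<Sum>r\<in>Poly_Mapping.keys m. length (leaf_path T r) * Poly_Mapping.lookup m r)"
      by (simp add: label_content_def size_multiset_sum mult.commute)
    then have "?E m + size (label_content m) =
        (\<Sum>r\<in>Poly_Mapping.keys m. (?e r + length (leaf_path T r)) * Poly_Mapping.lookup m r)"
      by (simp only: distrib_right sum.distrib)
    also have "\<dots> = (\<Sum>r\<in>Poly_Mapping.keys m. max_depth T * Poly_Mapping.lookup m r)"
      using leaf_path_length_le that by (intro sum.cong) (auto simp: last_leaves_def)
    finally show ?thesis
      by (simp add: mon_degree_def sum_distrib_left)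
  qed
  have "?E a = ?E b"
    using E[OF keys(1)] E[OF keys(2)] deg content by simp
  then have "mon_val (leaf_monomial T) a = mon_val (leaf_monomial T) b"
    unfolding leaf mon_val_leaves content by simp
  then have zero: "subst (leaf_monomial T) (monom a - monom b) = 0"
    using \<open>a \<noteq> b\<close> by (simp add: subst_monom_diff)
  have carrier: "monom a - monom b \<in> carrier (poly_ring last_leaves)"
    using keys by (intro diff_in_poly_ring) (simp_all add: monom_in_poly_ring_iff)
  moreover have "carrier (poly_ring last_leaves) \<subseteq> carrier (poly_ring leaf_numbers)"
    using last_leaves_subset by (rule poly_ring_mono)
  ultimately show ?thesis
    using zero by (auto simp: ker_phi_bar_iff kept_indices_eq[OF inner] phi_coset in_poly_ring_iff[of 0])
qed

end

section \<open>The quadratic Groebner basis\<close>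

definition pair_mon :: "nat \<Rightarrow> nat \<Rightarrow> (nat \<Rightarrow>\<^sub>0 nat)" where
  "pair_mon a c = Poly_Mapping.single a 1 + Poly_Mapping.single c 1"

lemma lookup_pair_mon: "Poly_Mapping.lookup (pair_mon a c) r = of_bool (r = a) + of_bool (r = c)"
  by (auto simp: pair_mon_def lookup_add lookup_single when_def)

lemma keys_pair_mon: "Poly_Mapping.keys (pair_mon a c) = {a, c}"
  by (auto simp: in_keys_iff lookup_pair_mon)

lemma mon_degree_pair_mon: "mon_degree (pair_mon a c) = 2"
  by (cases "a = c") (simp_all add: mon_degree_def keys_pair_mon lookup_pair_mon)

text \<open>The pairs differ at the index \<open>max a' c'\<close>, which exceeds both \<open>a\<close> and \<open>c\<close>.\<close>

lemma drl_gt_pair_mon: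
  assumes "c \<le> a" "a < a'"
  shows "drl_gt (pair_mon a c) (pair_mon a' c')"
proof -
  have "Poly_Mapping.lookup (pair_mon a c) (max a' c') < Poly_Mapping.lookup (pair_mon a' c') (max a' c')"
    "\<forall>j>max a' c'. Poly_Mapping.lookup (pair_mon a c) j = Poly_Mapping.lookup (pair_mon a' c') j"
    using assms by (auto simp: lookup_pair_mon max_def)
  then show ?thesis
    unfolding drl_gt_def by (metis mon_degree_pair_mon)
qed

lemma pair_mon_divides:
  assumes "a \<in> Poly_Mapping.keys m" "c \<in> Poly_Mapping.keys m" "a = c \<longrightarrow> Poly_Mapping.lookup m a \<ge> 2"
  shows "m = (m - pair_mon a c) + pair_mon a c"
proof (rule poly_mapping_eqI)
  fix r
  have "Poly_Mapping.lookup (pair_mon a c) r \<le> Poly_Mapping.lookup m r"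
    using assms by (auto simp: lookup_pair_mon in_keys_iff)
  then show "Poly_Mapping.lookup m r = Poly_Mapping.lookup (m - pair_mon a c + pair_mon a c) r"
    by (simp add: lookup_add lookup_minus)
qed

lemma (in balanced_tree) label_content_pair_mon:
  "label_content (pair_mon a c) = leaf_mono a + leaf_mono c"
  by (cases "a = c") (simp_all add: label_content_def keys_pair_mon lookup_pair_mon numeral_2_eq_2)

theorem theorem3p6:
  fixes T :: "'l plane_tree" and sim :: "nat list rel"
  assumes "staged_tree T sim"
    and "balanced T sim"
    and "branches T \<noteq> []"
  shows "groebner_basis drl_gt (kept_indices T)
           {f \<in> ker_phi_bar T. is_binomial f \<and> total_degree f = 2}
           (ker_phi_bar T)"
proof -
  interpret balanced_tree T sim
    using assms(1,2) by unfold_locales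
  note kept = kept_indices_eq[OF assms(3)]
  have carrier: "ker_phi_bar T \<subseteq> carrier (poly_ring (kept_indices T))"
    by (auto simp: ker_phi_bar_iff)
  show ?thesis
  proof (rule groebner_basisI[OF _ _ carrier])
    have "finite (kept_indices T)"
      unfolding kept using last_leaves_subset by (rule finite_subset) simp
    then show "finite {f \<in> ker_phi_bar T. is_binomial f \<and> total_degree f = 2}"
      using carrier by (intro finite_subset[OF _ finite_bounded_binomials[of "kept_indices T" 2]]) auto
    show "{f \<in> ker_phi_bar T. is_binomial f \<and> total_degree f = 2} \<subseteq> ker_phi_bar T"
      by auto
  next
    fix f assume f: "f \<in> ker_phi_bar T" "f \<noteq> 0"
    define m where "m = lead_mon drl_gt f"
    have f_ring: "f \<in> carrier (poly_ring last_leaves)" and f_phi: "phi T f = phi T 0"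
      using f(1) by (auto simp: ker_phi_bar_iff kept)
    then have f_leaves: "f \<in> carrier (poly_ring leaf_numbers)"
      using poly_ring_mono[OF last_leaves_subset] by blast
    have m: "m \<in> Poly_Mapping.keys f" "\<And>k. k \<in> Poly_Mapping.keys f \<Longrightarrow> k \<noteq> m \<Longrightarrow> drl_gt m k"
      using lead_mon_props[OF f(2)] by (simp_all add: m_def)
    obtain m' where m': "m' \<in> Poly_Mapping.keys f" "m' \<noteq> m" "mon_degree m' = mon_degree m"
      "label_content m' = label_content m"
      using homogeneous_partner[OF assms(3) f_leaves f_phi m(1)] by metis
    obtain a c a' c' where ac: "a \<in> Poly_Mapping.keys m" "c \<in> Poly_Mapping.keys m"
      "a = c \<longrightarrow> Poly_Mapping.lookup m a \<ge> 2"
      and ac': "a' \<in> last_leaves" "c' \<in> last_leaves" "c \<le> a" "a < a'"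
      and content: "leaf_mono a + leaf_mono c = leaf_mono a' + leaf_mono c'"
    proof (rule pair_moves_up[of m m'])
      show "drl_gt m m'" "mon_degree m = mon_degree m'" "label_content m = label_content m'"
        using m m' by auto
      show "Poly_Mapping.keys m \<subseteq> last_leaves" "Poly_Mapping.keys m' \<subseteq> leaf_numbers"
        using m(1) m'(1) f_ring f_leaves by (auto simp: in_poly_ring_iff)
    qed
    let ?e = "pair_mon a c" and ?e' = "pair_mon a' c'"
    let ?g = "monom ?e - monom ?e'"
    have gt: "drl_gt ?e ?e'"
      using ac' by (intro drl_gt_pair_mon)
    then have ne: "?e \<noteq> ?e'"
      using drl_gt_irrefl by metis
    have "?g \<in> ker_phi_bar T"
    proof (rule binomial_in_kernel[OF assms(3) ne])
      show "Poly_Mapping.keys ?e \<subseteq> last_leaves" "Poly_Mapping.keys ?e' \<subseteq> last_leaves"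
        using ac ac' m(1) f_ring by (auto simp: keys_pair_mon in_poly_ring_iff)
    qed (simp_all add: mon_degree_pair_mon label_content_pair_mon content)
    moreover have "is_binomial ?g"
      using ne by (auto simp: is_binomial_def)
    moreover have "total_degree ?g = 2"
      by (simp add: total_degree_def keys_monom_diff[OF ne] mon_degree_pair_mon)
    moreover have "?g \<noteq> 0"
      using keys_monom_diff[OF ne] by auto
    moreover have "lead_mon drl_gt ?g = ?e"
      using gt by (intro lead_mon_eqI) (auto simp: keys_monom_diff[OF ne])
    moreover have "\<exists>k. m = k + ?e"
      using pair_mon_divides[OF ac] by blast
    ultimately show "\<exists>g\<in>{f \<in> ker_phi_bar T. is_binomial f \<and> total_degree f = 2}.
        g \<noteq> 0 \<and> (\<exists>k. lead_mon drl_gt f = k + lead_mon drl_gt g)"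
      unfolding m_def[symmetric] by (intro bexI[of _ ?g]) simp_all
  qed
qed

end
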